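(* A commutative noetherian ring $A$ is almost Cohen-Macaulay if and only if $A$ has the property $(C_n)$ for every $n\in\mathbb{N}$.
   Context: All rings are commutative with unit. For a noetherian ring $A$ and $P\in\operatorname{Spec}(A)$, $\operatorname{depth}_P A$ denotes the common length of the maximal $A$-regular sequences contained in $P$, and for a noetherian local ring $R$, $\operatorname{depth}(R)$ is the depth with respect to its maximal ideal. The ring $A$ is called almost Cohen-Macaulay if $\operatorname{depth}_P A=\operatorname{depth}_{PA_P}A_P$ for every $P\in\operatorname{Spec}(A)$. For $n\in\mathbb{N}$, a noetherian ring $A$ has the property $(C_n)$ if $\operatorname{depth}(A_P)\geq\min(\operatorname{ht}(P),n)-1$ for every $P\in\operatorname{Spec}(A)$. *)

theory Defs
  imports
    "HOL-Algebra.Ideal"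
    "HOL-Algebra.QuotRing"
    "HOL-Algebra.Ring_Divisibility"
    "HOL-Library.Extended_Nat"
begin

section \<open>Localization at a prime ideal\<close>

definition frac_rel :: "('a, 'b) ring_scheme \<Rightarrow> 'a set \<Rightarrow> (('a \<times> 'a) \<times> ('a \<times> 'a)) set"
  where "frac_rel R S =
    {((a, s), (b, t)). a \<in> carrier R \<and> b \<in> carrier R \<and> s \<in> S \<and> t \<in> S \<and>
       (\<exists>u\<in>S. u \<otimes>\<^bsub>R\<^esub> (a \<otimes>\<^bsub>R\<^esub> t) = u \<otimes>\<^bsub>R\<^esub> (b \<otimes>\<^bsub>R\<^esub> s))}"

definition fraction :: "('a, 'b) ring_scheme \<Rightarrow> 'a set \<Rightarrow> 'a \<Rightarrow> 'a \<Rightarrow> ('a \<times> 'a) set"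
  where "fraction R S a s = frac_rel R S `` {(a, s)}"

text \<open>The ring of fractions at a multiplicative set \<open>S\<close>. In the sum and the product, the union
  over all representatives is a union of equal classes.\<close>

definition fraction_ring :: "('a, 'b) ring_scheme \<Rightarrow> 'a set \<Rightarrow> ('a \<times> 'a) set ring"
  where "fraction_ring R S =
    \<lparr> carrier = (carrier R \<times> S) // frac_rel R S,
      mult = (\<lambda>X Y. \<Union>(a, s)\<in>X. \<Union>(b, t)\<in>Y. fraction R S (a \<otimes>\<^bsub>R\<^esub> b) (s \<otimes>\<^bsub>R\<^esub> t)),
      one = fraction R S \<one>\<^bsub>R\<^esub> \<one>\<^bsub>R\<^esub>,
      zero = fraction R S \<zero>\<^bsub>R\<^esub> \<one>\<^bsub>R\<^esub>,
      add = (\<lambda>X Y. \<Union>(a, s)\<in>X. \<Union>(b, t)\<in>Y.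
        fraction R S (a \<otimes>\<^bsub>R\<^esub> t \<oplus>\<^bsub>R\<^esub> b \<otimes>\<^bsub>R\<^esub> s) (s \<otimes>\<^bsub>R\<^esub> t)) \<rparr>"

definition localization :: "('a, 'b) ring_scheme \<Rightarrow> 'a set \<Rightarrow> ('a \<times> 'a) set ring"
  where "localization R P = fraction_ring R (carrier R - P)"

text \<open>The extension \<open>P R\<^sub>P\<close> of \<open>P\<close> along the canonical map \<open>R \<rightarrow> R\<^sub>P\<close>.\<close>

definition localized_ideal :: "('a, 'b) ring_scheme \<Rightarrow> 'a set \<Rightarrow> ('a \<times> 'a) set set"
  where "localized_ideal R P =
    Idl\<^bsub>localization R P\<^esub> ((\<lambda>a. fraction R (carrier R - P) a \<one>\<^bsub>R\<^esub>) ` P)"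


section \<open>Regular sequences, depth and height\<close>

definition nonzerodivisor :: "('a, 'b) ring_scheme \<Rightarrow> 'a \<Rightarrow> bool"
  where "nonzerodivisor R x \<longleftrightarrow>
    x \<in> carrier R \<and> (\<forall>y\<in>carrier R. x \<otimes>\<^bsub>R\<^esub> y = \<zero>\<^bsub>R\<^esub> \<longrightarrow> y = \<zero>\<^bsub>R\<^esub>)"

text \<open>Each \<open>x\<^sub>i\<close> is a nonzerodivisor on \<open>R / (x\<^sub>1, \<dots>, x\<^bsub>i-1\<^esub>)\<close>, and \<open>R / (x\<^sub>1, \<dots>, x\<^sub>n) \<noteq> 0\<close>.\<close>

definition regular_sequence :: "('a, 'b) ring_scheme \<Rightarrow> 'a list \<Rightarrow> bool"
  where "regular_sequence R xs \<longleftrightarrow>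
    set xs \<subseteq> carrier R \<and>
    (\<forall>i<length xs. let I = Idl\<^bsub>R\<^esub> (set (take i xs)) in nonzerodivisor (R Quot I) (I +>\<^bsub>R\<^esub> (xs ! i))) \<and>
    Idl\<^bsub>R\<^esub> (set xs) \<noteq> carrier R"

definition maximal_regular_sequence_in :: "('a, 'b) ring_scheme \<Rightarrow> 'a set \<Rightarrow> 'a list \<Rightarrow> bool"
  where "maximal_regular_sequence_in R I xs \<longleftrightarrow>
    regular_sequence R xs \<and> set xs \<subseteq> I \<and> (\<forall>x\<in>I. \<not> regular_sequence R (xs @ [x]))"

text \<open>Only meaningful for a proper ideal \<open>I\<close> of a noetherian ring, where maximal regular
  sequences in \<open>I\<close> exist and have a common length.\<close>

definition depth :: "('a, 'b) ring_scheme \<Rightarrow> 'a set \<Rightarrow> nat"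
  where "depth R I = (THE n.
    (\<exists>xs. maximal_regular_sequence_in R I xs) \<and>
    (\<forall>xs. maximal_regular_sequence_in R I xs \<longrightarrow> length xs = n))"

text \<open>The depth of a local ring, with respect to its unique maximal ideal.\<close>

definition local_depth :: "('a, 'b) ring_scheme \<Rightarrow> nat"
  where "local_depth R = depth R (THE M. maximalideal M R)"

definition height :: "('a, 'b) ring_scheme \<Rightarrow> 'a set \<Rightarrow> enat"
  where "height R P = Sup {enat k | k. \<exists>p :: nat \<Rightarrow> 'a set.
    (\<forall>i\<le>k. primeideal (p i) R) \<and> (\<forall>i<k. p i \<subset> p (Suc i)) \<and> p k = P}"


section \<open>Almost Cohen-Macaulay rings and the properties \<open>(C\<^sub>n)\<close>\<close>

definition almost_cohen_macaulay :: "('a, 'b) ring_scheme \<Rightarrow> bool"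
  where "almost_cohen_macaulay R \<longleftrightarrow>
    (\<forall>P. primeideal P R \<longrightarrow> depth R P = depth (localization R P) (localized_ideal R P))"

text \<open>The subtraction truncates at \<open>0\<close>, which is harmless because the depth is nonnegative.\<close>

definition property_C :: "nat \<Rightarrow> ('a, 'b) ring_scheme \<Rightarrow> bool"
  where "property_C n R \<longleftrightarrow>
    (\<forall>P. primeideal P R \<longrightarrow>
      enat (local_depth (localization R P)) \<ge> min (height R P) (enat n) - 1)"

end

theory Submission
  imports Defs
begin

text \<open>If \<open>x\<^sub>1, \<dots>, x\<^sub>n\<close> is a maximal regular sequence in a prime \<open>P\<close>, then \<open>P\<close> lies in an associated prime of
  \<open>A / (x\<^sub>1, \<dots>, x\<^sub>n)\<close>, and for every prime \<open>Q\<close> containing the sequence, \<open>depth A\<^sub>Q = n\<close> holds exactly when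
  \<open>Q\<close> is such an associated prime.

  Let \<open>A\<close> be almost Cohen-Macaulay. The sequence remains maximal in every prime \<open>Q \<subseteq> P\<close> that contains it, so
  \<open>depth A\<^sub>Q = n\<close>, and all these \<open>Q\<close> belong to the finite set of associated primes. By prime
  avoidance some \<open>y \<in> P\<close> avoids all of them except \<open>P\<close>. Hence \<open>P\<close> is minimal over \<open>(x\<^sub>1, \<dots>, x\<^sub>n, y)\<close>, and
  Krull's height theorem gives \<open>ht P \<le> n + 1 = depth A\<^sub>P + 1\<close>.

  Conversely, let \<open>ht Q \<le> depth A\<^sub>Q + 1\<close> for all \<open>Q\<close>, and take an associated prime \<open>Q \<supseteq> P\<close>, so that
  \<open>depth A\<^sub>Q = n\<close>. If \<open>Q \<noteq> P\<close>, then \<open>n \<ge> ht Q - 1 \<ge> ht P \<ge> depth A\<^sub>P \<ge> n\<close>.\<close>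


section \<open>Associated primes\<close>

text \<open>Modules are represented by ideals: \<open>R / L\<close> by \<open>L\<close>, and in
  Krull's theorem its localization by ideals saturated at a prime. The theory of depth is developed
  once for noetherian rings and then applied both to \<open>A\<close> and to \<open>A_P\<close>,
  which is built as a ring of fractions.

  Two facts have to be supplied before the overview can be carried out. Since \<open>depth\<close>
  is a definite description, all maximal regular sequences in an ideal must be shown to have one
  length; an exchange argument on the relation \<open>annihilated\<close> does the work of Ext here.
  The converse also uses depth \<open>A_P\<close> \<le> ht \<open>P\<close>: a nonzerodivisor modulo
  \<open>I\<close> is missed by some prime between \<open>I\<close> and any prime above
  \<open>I\<close>, so every term of a regular sequence lengthens a chain.

  The 1 in \<open>(C_n)\<close> is the single extra generator \<open>y\<close> in one direction and
  the single step from \<open>P\<close> to a strictly larger \<open>Q\<close> in the other.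
  Quantifying over all \<open>n\<close> removes the truncation by the minimum and makes every height
  finite.\<close>

locale noetherian_cring = noetherian_ring + cring

section \<open>Ideals and primes in a commutative ring\<close>

context cring
begin

lemma idealI_cring:
  assumes "I \<subseteq> carrier R" "\<zero> \<in> I" "\<And>a b. a \<in> I \<Longrightarrow> b \<in> I \<Longrightarrow> a \<oplus> b \<in> I"
    and "\<And>r a. r \<in> carrier R \<Longrightarrow> a \<in> I \<Longrightarrow> r \<otimes> a \<in> I"
  shows "ideal I R"
proof (rule idealI[OF ring_axioms])
  have "\<ominus> a \<in> I" if "a \<in> I" for a
    using assms(4)[of "\<ominus> \<one>" a] that assms(1) l_minus[of \<one> a] by auto
  then show "subgroup I (add_monoid R)"
    using assms by (intro add.subgroupI) (auto simp: a_inv_def)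
  show "a \<in> I \<Longrightarrow> x \<in> carrier R \<Longrightarrow> x \<otimes> a \<in> I" for a x using assms by auto
  show "a \<in> I \<Longrightarrow> x \<in> carrier R \<Longrightarrow> a \<otimes> x \<in> I" for a x
    using assms(4)[of x a] assms(1) m_comm[of x a] by auto
qed

lemma
  assumes "ideal I R"
  shows ideal_subset: "I \<subseteq> carrier R"
    and ideal_carrier: "a \<in> I \<Longrightarrow> a \<in> carrier R"
    and ideal_zero: "\<zero> \<in> I"
    and ideal_add: "a \<in> I \<Longrightarrow> b \<in> I \<Longrightarrow> a \<oplus> b \<in> I"
    and ideal_lmult: "r \<in> carrier R \<Longrightarrow> a \<in> I \<Longrightarrow> r \<otimes> a \<in> I"
    and ideal_rmult: "r \<in> carrier R \<Longrightarrow> a \<in> I \<Longrightarrow> a \<otimes> r \<in> I"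
    and ideal_uminus: "a \<in> I \<Longrightarrow> \<ominus> a \<in> I"
    and ideal_minus: "a \<in> I \<Longrightarrow> b \<in> I \<Longrightarrow> a \<ominus> b \<in> I"
proof -
  interpret I: ideal I R by fact
  show "I \<subseteq> carrier R" "a \<in> I \<Longrightarrow> a \<in> carrier R" "\<zero> \<in> I" "a \<in> I \<Longrightarrow> b \<in> I \<Longrightarrow> a \<oplus> b \<in> I"
    "r \<in> carrier R \<Longrightarrow> a \<in> I \<Longrightarrow> r \<otimes> a \<in> I" "r \<in> carrier R \<Longrightarrow> a \<in> I \<Longrightarrow> a \<otimes> r \<in> I"
    "a \<in> I \<Longrightarrow> \<ominus> a \<in> I" "a \<in> I \<Longrightarrow> b \<in> I \<Longrightarrow> a \<ominus> b \<in> I"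
    using I.a_subset I.I_l_closed I.I_r_closed by (auto simp: a_minus_def)
qed

lemma ideal_add_cancel:
  assumes "ideal I R" "a \<oplus> b \<in> I" "a \<in> I" "b \<in> carrier R"
  shows "b \<in> I"
proof -
  have "b = (a \<oplus> b) \<ominus> a"
    using assms ideal_carrier[OF assms(1)] by algebra
  then show ?thesis using ideal_minus assms by metis
qed

lemma ideal_add_cancel2:
  assumes "ideal I R" "a \<oplus> b \<in> I" "b \<in> I" "a \<in> carrier R"
  shows "a \<in> I"
  using ideal_add_cancel[of I b a] assms a_comm ideal_carrier by metis

lemma ideal_eq_carrier: "ideal I R \<Longrightarrow> \<one> \<in> I \<longleftrightarrow> I = carrier R"
  using ideal.one_imp_carrier by auto

lemma
  assumes "primeideal P R"
  shows prime_ideal: "ideal P R" and prime_one: "\<one> \<notin> P" and prime_proper: "P \<noteq> carrier R"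
    and prime_mult: "a \<in> carrier R \<Longrightarrow> b \<in> carrier R \<Longrightarrow> a \<otimes> b \<in> P \<Longrightarrow> a \<in> P \<or> b \<in> P"
proof -
  interpret P: primeideal P R by fact
  show "ideal P R" by (rule P.is_ideal)
  then show "\<one> \<notin> P" "P \<noteq> carrier R" using P.I_notcarr ideal_eq_carrier by auto
  show "a \<in> carrier R \<Longrightarrow> b \<in> carrier R \<Longrightarrow> a \<otimes> b \<in> P \<Longrightarrow> a \<in> P \<or> b \<in> P" by (rule P.I_prime)
qed

lemma primeI:
  assumes "ideal P R" "\<one> \<notin> P"
    and "\<And>a b. a \<in> carrier R \<Longrightarrow> b \<in> carrier R \<Longrightarrow> a \<otimes> b \<in> P \<Longrightarrow> a \<notin> P \<Longrightarrow> b \<in> P"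
  shows "primeideal P R"
  by (rule primeidealI[OF assms(1) is_cring]) (use assms in blast)+

lemma prime_pow:
  fixes n :: nat
  assumes "primeideal P R" "a \<in> carrier R" "a [^] n \<in> P"
  shows "a \<in> P"
  using assms(3)
proof (induction n)
  case 0
  then show ?case using prime_one[OF assms(1)] by simp
next
  case (Suc n)
  then show ?case using prime_mult[OF assms(1), of "a [^] n" a] assms(2) by auto
qed

text \<open>The ideal \<open>L + (a)\<close>, written out so that each element comes with a
  decomposition. It represents the quotient of \<open>R / L\<close> by the submodule generated by
  the class of \<open>a\<close>.\<close>

definition adj :: "'a set \<Rightarrow> 'a \<Rightarrow> 'a set"
  where "adj L a = {l \<oplus> r \<otimes> a | l r. l \<in> L \<and> r \<in> carrier R}"

lemma adjI: "l \<in> L \<Longrightarrow> r \<in> carrier R \<Longrightarrow> l \<oplus> r \<otimes> a \<in> adj L a"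
  unfolding adj_def by auto

lemma adjE:
  assumes "b \<in> adj L a"
  obtains l r where "l \<in> L" "r \<in> carrier R" "b = l \<oplus> r \<otimes> a"
  using assms unfolding adj_def by auto

text \<open>The annihilator of the class of \<open>a\<close> in \<open>R / L\<close>.\<close>

definition colon :: "'a set \<Rightarrow> 'a \<Rightarrow> 'a set"
  where "colon L a = {r \<in> carrier R. r \<otimes> a \<in> L}"

context
  fixes L a
  assumes L: "ideal L R" and a: "a \<in> carrier R"
begin

lemma adj_ideal: "ideal (adj L a) R"
proof (rule idealI_cring)
  note Lc = ideal_carrier[OF L]
  show "adj L a \<subseteq> carrier R" using Lc a by (auto elim!: adjE)
  show "\<zero> \<in> adj L a" using adjI[OF ideal_zero[OF L] zero_closed, of a] a by simp
  fix x y r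
  assume x: "x \<in> adj L a"
  then obtain l s where l: "l \<in> L" "s \<in> carrier R" "x = l \<oplus> s \<otimes> a" by (rule adjE)
  { assume "y \<in> adj L a"
    then obtain m t where m: "m \<in> L" "t \<in> carrier R" "y = m \<oplus> t \<otimes> a" by (rule adjE)
    have "x \<oplus> y = (l \<oplus> m) \<oplus> (s \<oplus> t) \<otimes> a"
      using l m a Lc[OF l(1)] Lc[OF m(1)] by algebra
    then show "x \<oplus> y \<in> adj L a" using adjI[OF ideal_add[OF L l(1) m(1)]] l m by auto }
  assume r: "r \<in> carrier R"
  have "r \<otimes> x = r \<otimes> l \<oplus> (r \<otimes> s) \<otimes> a" using l r a Lc[OF l(1)] by algebra
  then show "r \<otimes> x \<in> adj L a" using adjI[OF ideal_lmult[OF L r l(1)]] l r by auto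
qed

lemma subset_adj: "L \<subseteq> adj L a"
proof
  fix l assume "l \<in> L"
  then show "l \<in> adj L a"
    using adjI[of l L \<zero> a] ideal_carrier[OF L] a by auto
qed

lemma self_in_adj: "a \<in> adj L a"
  using adjI[of \<zero> L \<one> a] ideal_zero[OF L] a by simp

lemma adj_minimal: "ideal M R \<Longrightarrow> L \<subseteq> M \<Longrightarrow> a \<in> M \<Longrightarrow> adj L a \<subseteq> M"
  using ideal_add ideal_lmult by (auto elim!: adjE)

lemma colon_ideal: "ideal (colon L a) R"
  unfolding colon_def
proof (rule idealI_cring)
  fix r s assume "r \<in> {r \<in> carrier R. r \<otimes> a \<in> L}"
  then have r: "r \<in> carrier R" "r \<otimes> a \<in> L" by auto
  { assume "s \<in> {r \<in> carrier R. r \<otimes> a \<in> L}"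
    then show "r \<oplus> s \<in> {r \<in> carrier R. r \<otimes> a \<in> L}"
      using r ideal_add[OF L] a by (auto simp: l_distr) }
  assume "s \<in> carrier R"
  then show "s \<otimes> r \<in> {r \<in> carrier R. r \<otimes> a \<in> L}"
    using r ideal_lmult[OF L] a by (auto simp: m_assoc)
qed (use ideal_zero[OF L] a in auto)

end

lemma adj_mono: "L \<subseteq> M \<Longrightarrow> adj L a \<subseteq> adj M a"
  unfolding adj_def by auto

lemma adj_commute:
  assumes "ideal L R" "a \<in> carrier R" "b \<in> carrier R"
  shows "adj (adj L a) b = adj (adj L b) a"
proof -
  have "adj (adj L a) b \<subseteq> adj (adj L b) a" if "a \<in> carrier R" "b \<in> carrier R" for a b
    using that assms(1) subset_adj self_in_adj adj_ideal
    by (intro adj_minimal) (meson in_mono subset_trans)+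
  then show ?thesis using assms by auto
qed

section \<open>Associated primes of the module \<open>R / L\<close>, zero divisors on it, and prime
  avoidance\<close>

definition assoc_primes :: "'a set \<Rightarrow> 'a set set"
  where "assoc_primes L = {P. primeideal P R \<and> (\<exists>a\<in>carrier R. P = colon L a)}"

text \<open>A nonzerodivisor on the module \<open>R / L\<close>. For \<open>L = carrier R\<close>
  every ring element qualifies, so properness of ideals is tracked separately.\<close>

definition nzd :: "'a set \<Rightarrow> 'a \<Rightarrow> bool"
  where "nzd L x \<longleftrightarrow> x \<in> carrier R \<and> (\<forall>y\<in>carrier R. x \<otimes> y \<in> L \<longrightarrow> y \<in> L)"

lemma prime_avoidance:
  assumes "finite F" "\<And>P. P \<in> F \<Longrightarrow> primeideal P R" "ideal I R" "I \<subseteq> \<Union>F"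
  shows "\<exists>P\<in>F. I \<subseteq> P"
  using assms
proof (induction F rule: finite_psubset_induct)
  case (psubset F)
  show ?case
  proof (cases "\<exists>P\<in>F. I \<subseteq> \<Union>(F - {P})")
    case True
    then obtain P where P: "P \<in> F" "I \<subseteq> \<Union>(F - {P})" by auto
    have "\<exists>P\<in>F - {P}. I \<subseteq> P" using psubset P by (intro psubset.IH) auto
    then show ?thesis by auto
  next
    case False
    then have "\<forall>P\<in>F. \<exists>x\<in>I. x \<notin> \<Union>(F - {P})" by blast
    then obtain x where x: "\<And>P. P \<in> F \<Longrightarrow> x P \<in> I \<and> x P \<notin> \<Union>(F - {P})" by metis
    have xP: "x P \<in> P" if "P \<in> F" for P using x[OF that] psubset.prems by auto
    have "F \<noteq> {}" using psubset.prems ideal_zero[OF psubset.prems(2)] by auto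
    then obtain P where P: "P \<in> F" by auto
    have prP: "primeideal P R" using psubset.prems P by auto
    \<comment> \<open>A single prime is treated apart, because the product over the remaining primes
      would then be \<open>\<one>\<close>, which need not lie in \<open>I\<close>.\<close>
    show ?thesis
    proof (cases "F = {P}")
      case True then show ?thesis using psubset.prems by auto
    next
      case nonsing: False
      have Ic: "x Q \<in> carrier R" if "Q \<in> F" for Q
        using x[OF that] ideal_carrier[OF psubset.prems(2)] by auto
      define y where "y = finprod R x (F - {P})"
      have prod: "finprod R x G \<in> carrier R \<and> (\<forall>Q\<in>G. finprod R x G \<in> Q) \<and> finprod R x G \<notin> P
          \<and> (G \<noteq> {} \<longrightarrow> finprod R x G \<in> I)"
        if "finite G" "G \<subseteq> F - {P}" for G
        using that
      proof (induction G rule: finite_induct)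
        case empty
        then show ?case using prime_one[OF prP] by auto
      next
        case (insert Q G)
        have Q: "Q \<in> F" "Q \<noteq> P" using insert by auto
        have eq: "finprod R x (insert Q G) = x Q \<otimes> finprod R x G"
          using insert Ic by (intro finprod_insert) auto
        have IH: "finprod R x G \<in> carrier R" "\<forall>Q\<in>G. finprod R x G \<in> Q" "finprod R x G \<notin> P"
          using insert by auto
        have "x Q \<notin> P" using x[OF Q(1)] Q P by auto
        then have "x Q \<otimes> finprod R x G \<notin> P" using prime_mult[OF prP] IH Ic Q by auto
        moreover have "x Q \<otimes> finprod R x G \<in> Q"
          using ideal_rmult[OF prime_ideal, of Q] xP[OF Q(1)] IH Q psubset.prems by auto
        moreover have "x Q \<otimes> finprod R x G \<in> S" if "S \<in> G" for S
          using ideal_lmult[OF prime_ideal, of S] IH that Ic Q insert.prems psubset.prems(1) by auto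
        moreover have "x Q \<otimes> finprod R x G \<in> I"
          using ideal_rmult[OF psubset.prems(2)] x[OF Q(1)] IH by auto
        ultimately show ?case using eq IH Ic Q by auto
      qed
      have ne: "F - {P} \<noteq> {}" using nonsing P by auto
      have y: "y \<in> carrier R" "\<And>Q. Q \<in> F \<Longrightarrow> Q \<noteq> P \<Longrightarrow> y \<in> Q" "y \<notin> P" "y \<in> I"
        using prod[of "F - {P}"] psubset.hyps ne unfolding y_def by auto
      have sum: "x P \<oplus> y \<in> I" using x[OF P] y ideal_add[OF psubset.prems(2)] by auto
      then obtain Q where Q: "Q \<in> F" "x P \<oplus> y \<in> Q" using psubset.prems by auto
      have idQ: "ideal Q R" using Q psubset.prems prime_ideal by auto
      have False
      proof (cases "Q = P")
        case True
        then show False using ideal_add_cancel[OF idQ Q(2)] xP[OF P] y by auto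
      next
        case False
        then show False using ideal_add_cancel2[OF idQ Q(2)] y Q Ic[OF P] x[OF P] by auto
      qed
      then show ?thesis ..
    qed
  qed
qed

end

section \<open>Existence and finiteness of associated primes\<close>

context noetherian_cring
begin

lemma exists_maximal_ideal_in:
  assumes "F \<noteq> {}" "\<And>I. I \<in> F \<Longrightarrow> ideal I R"
  shows "\<exists>M\<in>F. \<forall>X\<in>F. M \<subseteq> X \<longrightarrow> X = M"
proof (rule subset_Zorn_nonempty[OF assms(1)])
  fix C assume C: "C \<noteq> {}" "subset.chain F C"
  then have "subset.chain {I. ideal I R} C" using assms(2) unfolding subset.chain_def by auto
  then have "\<Union>C \<in> C" using ideal_chain_is_trivial C by auto
  then show "\<Union>C \<in> F" using C unfolding subset.chain_def by auto
qed

lemma noetherian_induct [consumes 1, case_names step]: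
  assumes "ideal L R"
    and step: "\<And>L. ideal L R \<Longrightarrow> (\<And>M. ideal M R \<Longrightarrow> L \<subset> M \<Longrightarrow> \<phi> M) \<Longrightarrow> \<phi> L"
  shows "\<phi> L"
proof (rule ccontr)
  assume "\<not> \<phi> L"
  then have "{L. ideal L R \<and> \<not> \<phi> L} \<noteq> {}" using assms(1) by auto
  from exists_maximal_ideal_in[OF this] obtain M where M: "ideal M R" "\<not> \<phi> M"
    "\<And>J. ideal J R \<Longrightarrow> \<not> \<phi> J \<Longrightarrow> M \<subseteq> J \<Longrightarrow> J = M"
    by auto
  then show False using step[of M] by blast
qed

text \<open>A maximal member of the set of annihilators \<open>colon L c\<close> with
  \<open>c \<notin> L\<close> that contain \<open>x\<close> is prime: for \<open>a\<close> outside
  it, \<open>colon L (a \<otimes> c)\<close> is again a member and is larger or equal, hence the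
  same.\<close>

lemma zero_divisor_in_assoc_prime:
  assumes L: "ideal L R" and x: "x \<in> carrier R" and nx: "\<not> nzd L x"
  obtains P where "P \<in> assoc_primes L" "x \<in> P"
proof -
  let ?F = "{colon L c | c. c \<in> carrier R \<and> c \<notin> L \<and> x \<in> colon L c}"
  obtain y where "y \<in> carrier R" "x \<otimes> y \<in> L" "y \<notin> L" using nx x unfolding nzd_def by auto
  then have "?F \<noteq> {}" using x unfolding colon_def by auto
  moreover have "\<And>I. I \<in> ?F \<Longrightarrow> ideal I R" using colon_ideal[OF L] unfolding colon_def by auto
  ultimately have "\<exists>M\<in>?F. \<forall>X\<in>?F. M \<subseteq> X \<longrightarrow> X = M" by (rule exists_maximal_ideal_in)
  then obtain M where M: "M \<in> ?F" and max: "\<forall>X\<in>?F. M \<subseteq> X \<longrightarrow> X = M" by (rule bexE)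
  then obtain c where c: "M = colon L c" "c \<in> carrier R" "c \<notin> L" "x \<in> colon L c" by blast
  have "primeideal M R"
  proof (rule primeI)
    show "ideal M R" using c colon_ideal[OF L c(2)] unfolding colon_def by auto
    show "\<one> \<notin> M" using c unfolding colon_def by auto
    fix a b assume ab: "a \<in> carrier R" "b \<in> carrier R" "a \<otimes> b \<in> M" "a \<notin> M"
    have "a \<otimes> c \<notin> L" using ab c unfolding colon_def by auto
    moreover have sub: "colon L c \<subseteq> colon L (a \<otimes> c)"
      unfolding colon_def using ab(1) c(2) ideal_lmult[OF L] by (auto simp: m_lcomm[of _ a c])
    ultimately have "colon L (a \<otimes> c) \<in> ?F" using c ab by auto
    then have "colon L (a \<otimes> c) = M" using max sub c(1) by blast
    moreover have "b \<in> colon L (a \<otimes> c)"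
      using ab c unfolding colon_def by (auto simp: m_ac)
    ultimately show "b \<in> M" by simp
  qed
  then show ?thesis using that[of M] c unfolding assoc_primes_def by auto
qed

lemma exists_assoc_prime:
  assumes L: "ideal L R" "L \<noteq> carrier R"
  obtains P where "P \<in> assoc_primes L"
proof -
  \<comment> \<open>On a nonzero module even \<open>\<zero>\<close> is a zero divisor, so it lies in
    an associated prime.\<close>
  have "\<not> nzd L \<zero>" using L ideal_eq_carrier ideal_zero unfolding nzd_def
    by (metis l_null one_closed)
  then show ?thesis using zero_divisor_in_assoc_prime[OF L(1)] that by blast
qed

end

context cring
begin

lemma assoc_prime_zero_divisors:
  assumes "ideal L R" "P \<in> assoc_primes L" "x \<in> P"
  shows "\<not> nzd L x"
proof -
  obtain a where a: "a \<in> carrier R" "P = colon L a" "primeideal P R"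
    using assms unfolding assoc_primes_def by auto
  have "a \<notin> L" using prime_one[OF a(3)] a unfolding colon_def by auto
  then show ?thesis using assms a unfolding nzd_def colon_def by auto
qed

lemma assoc_prime_contains:
  assumes "ideal L R" "P \<in> assoc_primes L"
  shows "L \<subseteq> P"
  using assms ideal_rmult ideal_carrier unfolding assoc_primes_def colon_def by fastforce

end

context noetherian_cring
begin

text \<open>\<open>R / L\<close> has the submodule generated by \<open>a\<close>, with quotient
  \<open>R / adj L a\<close>. If a nonzero multiple of \<open>c\<close> falls into that submodule,
  its annihilator is both \<open>colon L c\<close> and \<open>colon L a\<close>; otherwise the
  module generated by \<open>c\<close> embeds into the quotient, and \<open>colon L c\<close> is
  unchanged there.\<close>

lemma assoc_primes_adj:
  assumes L: "ideal L R" and a: "a \<in> carrier R" and p: "primeideal (colon L a) R"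
  shows "assoc_primes L \<subseteq> insert (colon L a) (assoc_primes (adj L a))"
proof
  fix Q assume "Q \<in> assoc_primes L"
  then obtain c where c: "c \<in> carrier R" "Q = colon L c" "primeideal Q R"
    unfolding assoc_primes_def by auto
  \<comment> \<open>The submodule of \<open>R / L\<close> generated by \<open>d\<close> is isomorphic to the domain \<open>R / colon L d\<close>.\<close>
  have mult: "colon L (l \<oplus> r \<otimes> d) = colon L d"
    if l: "l \<in> L" and r: "r \<in> carrier R" and d: "d \<in> carrier R"
      and pr: "primeideal (colon L d) R" and n: "l \<oplus> r \<otimes> d \<notin> L" for l r d
  proof -
    have lc: "l \<in> carrier R" using l ideal_carrier[OF L] by auto
    have nr: "r \<notin> colon L d" using n r ideal_add[OF L l] unfolding colon_def by auto
    have "s \<otimes> (l \<oplus> r \<otimes> d) \<in> L \<longleftrightarrow> s \<otimes> d \<in> L" if s: "s \<in> carrier R" for s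
    proof -
      have eq: "s \<otimes> (l \<oplus> r \<otimes> d) = s \<otimes> l \<oplus> s \<otimes> (r \<otimes> d)" using s lc r d by algebra
      have sl: "s \<otimes> l \<in> L" using ideal_lmult[OF L s l] .
      have "s \<otimes> (l \<oplus> r \<otimes> d) \<in> L \<longleftrightarrow> s \<otimes> (r \<otimes> d) \<in> L"
        unfolding eq using ideal_add[OF L sl] ideal_add_cancel[OF L _ sl] s r d by (meson m_closed)
      also have "\<dots> \<longleftrightarrow> s \<otimes> r \<in> colon L d"
        using s r d unfolding colon_def by (simp add: m_assoc)
      also have "\<dots> \<longleftrightarrow> s \<in> colon L d"
        using prime_mult[OF pr s r] nr ideal_rmult[OF prime_ideal[OF pr] r] by blast
      finally show ?thesis using s unfolding colon_def by auto
    qed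
    then show ?thesis unfolding colon_def by auto
  qed
  show "Q \<in> insert (colon L a) (assoc_primes (adj L a))"
  proof (cases "\<exists>r\<in>carrier R. r \<otimes> c \<notin> L \<and> r \<otimes> c \<in> adj L a")
    case True
    then obtain r l s where r: "r \<in> carrier R" "r \<otimes> c \<notin> L" "l \<in> L" "s \<in> carrier R" "r \<otimes> c = l \<oplus> s \<otimes> a"
      by (auto elim!: adjE)
    have "colon L (\<zero> \<oplus> r \<otimes> c) = colon L c"
      using r(1,2) c l_zero[of "r \<otimes> c"] by (intro mult ideal_zero[OF L]) auto
    moreover have "\<zero> \<oplus> r \<otimes> c = l \<oplus> s \<otimes> a"
      using l_zero[OF m_closed[OF r(1) c(1)]] r(5) by simp
    moreover have "colon L (l \<oplus> s \<otimes> a) = colon L a" using r(2-5) p a by (intro mult) auto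
    ultimately show ?thesis using c(2) by simp
  next
    case False
    then have "Q = colon (adj L a) c"
      using c subset_adj[OF L a] unfolding colon_def by auto
    then show ?thesis using c unfolding assoc_primes_def by auto
  qed
qed

text \<open>Passing from \<open>L\<close> to the strictly larger \<open>adj L a\<close> loses at
  most one associated prime.\<close>

lemma finite_assoc_primes:
  assumes "ideal L R"
  shows "finite (assoc_primes L)"
  using assms
proof (induction rule: noetherian_induct)
  case (step L)
  show ?case
  proof (cases "assoc_primes L = {}")
    case True then show ?thesis by simp
  next
    case False
    then obtain P where P: "P \<in> assoc_primes L" by blast
    then obtain a where a: "primeideal P R" "a \<in> carrier R" "P = colon L a"
      unfolding assoc_primes_def by auto
    have "a \<notin> L" using prime_one[OF a(1)] a unfolding colon_def by auto
    then have "L \<subset> adj L a" using subset_adj self_in_adj step.hyps a by blast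
    then have "finite (assoc_primes (adj L a))" using step adj_ideal a by blast
    then show ?thesis using assoc_primes_adj[OF step.hyps a(2)] a by (metis finite_insert finite_subset)
  qed
qed

text \<open>Otherwise the finitely many associated primes of all the \<open>L\<close> together cover
  \<open>I\<close>. Prime avoidance puts \<open>I\<close> into one of them, and then the
  corresponding \<open>L\<close> has no nonzerodivisor in \<open>I\<close>.\<close>

lemma exists_common_nzd:
  assumes I: "ideal I R" and F: "finite F" "\<And>L. L \<in> F \<Longrightarrow> ideal L R"
    and ex: "\<And>L. L \<in> F \<Longrightarrow> \<exists>x\<in>I. nzd L x"
  shows "\<exists>z\<in>I. \<forall>L\<in>F. nzd L z"
proof (rule ccontr)
  assume "\<not> ?thesis"
  then have "\<exists>P \<in> \<Union>(assoc_primes ` F). x \<in> P" if "x \<in> I" for x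
    using that zero_divisor_in_assoc_prime F ideal_carrier[OF I that] by (metis UN_iff)
  then have "I \<subseteq> \<Union>(\<Union>(assoc_primes ` F))" by blast
  moreover have "finite (\<Union>(assoc_primes ` F))" using F finite_assoc_primes by blast
  moreover have "primeideal P R" if "P \<in> \<Union>(assoc_primes ` F)" for P
    using that unfolding assoc_primes_def by blast
  ultimately obtain P where "P \<in> \<Union>(assoc_primes ` F)" "I \<subseteq> P"
    using prime_avoidance[of "\<Union>(assoc_primes ` F)" I] I by blast
  then show False using ex assoc_prime_zero_divisors F by blast
qed

end


section \<open>Krull's height theorem\<close>

context cring
begin

text \<open>The preimage in \<open>R\<close> of the extension of \<open>L\<close> to the
  localization at \<open>P\<close>. Saturated ideals stand for the ideals of that local ring and
  keep the proof of Krull's theorem inside \<open>R\<close>.\<close>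

definition saturation :: "'a set \<Rightarrow> 'a set \<Rightarrow> 'a set"
  where "saturation P L = {a \<in> carrier R. \<exists>s\<in>carrier R - P. s \<otimes> a \<in> L}"

definition saturated :: "'a set \<Rightarrow> 'a set \<Rightarrow> bool"
  where "saturated P L \<longleftrightarrow> (\<forall>s\<in>carrier R - P. \<forall>a\<in>carrier R. s \<otimes> a \<in> L \<longrightarrow> a \<in> L)"

lemma saturatedD:
  "saturated P L \<Longrightarrow> s \<in> carrier R \<Longrightarrow> s \<notin> P \<Longrightarrow> a \<in> carrier R \<Longrightarrow> s \<otimes> a \<in> L \<Longrightarrow> a \<in> L"
  unfolding saturated_def by auto

lemma saturated_antimono: "P \<subseteq> Q \<Longrightarrow> saturated P L \<Longrightarrow> saturated Q L"
  unfolding saturated_def by auto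

lemma saturation_mono: "L \<subseteq> M \<Longrightarrow> saturation P L \<subseteq> saturation P M"
  unfolding saturation_def by auto

lemma saturation_minimal: "saturated P M \<Longrightarrow> L \<subseteq> M \<Longrightarrow> saturation P L \<subseteq> M"
  unfolding saturation_def saturated_def by auto

context
  fixes P L
  assumes P: "primeideal P R" and L: "ideal L R"
begin

lemma subset_saturation: "L \<subseteq> saturation P L"
  using prime_one[OF P] ideal_carrier[OF L] unfolding saturation_def by force

lemma saturation_ideal: "ideal (saturation P L) R"
proof (rule idealI_cring)
  show "\<zero> \<in> saturation P L" using subset_saturation ideal_zero[OF L] by auto
  fix a b assume "a \<in> saturation P L"
  then obtain s where s: "a \<in> carrier R" "s \<in> carrier R" "s \<notin> P" "s \<otimes> a \<in> L"
    unfolding saturation_def by auto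
  { assume "b \<in> saturation P L"
    then obtain t where t: "b \<in> carrier R" "t \<in> carrier R" "t \<notin> P" "t \<otimes> b \<in> L"
      unfolding saturation_def by auto
    have "s \<otimes> t \<notin> P" using prime_mult[OF P] s t by auto
    moreover have "(s \<otimes> t) \<otimes> (a \<oplus> b) = t \<otimes> (s \<otimes> a) \<oplus> s \<otimes> (t \<otimes> b)" using s t by algebra
    moreover have "t \<otimes> (s \<otimes> a) \<oplus> s \<otimes> (t \<otimes> b) \<in> L"
      using s t ideal_add[OF L] ideal_lmult[OF L] by auto
    ultimately show "a \<oplus> b \<in> saturation P L"
      using s t unfolding saturation_def by (auto intro!: bexI[of _ "s \<otimes> t"]) }
  assume b: "b \<in> carrier R"
  have "s \<otimes> (b \<otimes> a) = b \<otimes> (s \<otimes> a)" using s b by algebra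
  then show "b \<otimes> a \<in> saturation P L"
    using s b ideal_lmult[OF L b] unfolding saturation_def by force
qed (auto simp: saturation_def)

lemma saturated_saturation: "saturated P (saturation P L)"
  unfolding saturated_def
proof (intro ballI impI)
  fix s a assume s: "s \<in> carrier R - P" and a: "a \<in> carrier R" and "s \<otimes> a \<in> saturation P L"
  then obtain t where t: "t \<in> carrier R" "t \<notin> P" "t \<otimes> (s \<otimes> a) \<in> L"
    unfolding saturation_def by auto
  have "t \<otimes> s \<notin> P" using prime_mult[OF P] s t by auto
  moreover have "(t \<otimes> s) \<otimes> a \<in> L" using t s a by (simp add: m_assoc)
  ultimately show "a \<in> saturation P L"
    using s t a unfolding saturation_def by (auto intro!: bexI[of _ "t \<otimes> s"])
qed

end

end

section \<open>Local artinian quotients, Nakayama's lemma and the principal ideal theorem\<close>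

context noetherian_cring
begin

text \<open>The ideals of \<open>(R / L)\<^sub>P\<close> correspond to the \<open>P\<close>-saturated ideals above \<open>L\<close>, so this says that
  \<open>(R / L)\<^sub>P\<close> is artinian.\<close>

lemma descending_chain_stabilizes:
  assumes P: "primeideal P R" and L: "ideal L R" "saturated P L"
    and min: "\<And>Q. primeideal Q R \<Longrightarrow> L \<subseteq> Q \<Longrightarrow> Q \<subseteq> P \<Longrightarrow> Q = P"
    and K: "\<And>i. ideal (K i) R" "\<And>i. saturated P (K i)" "\<And>i. L \<subseteq> K i" "\<And>i. K (Suc i) \<subseteq> K i"
  shows "\<exists>n. K (Suc n) = K n"
  using L min K
proof (induction arbitrary: K rule: noetherian_induct)
  case (step L)
  show ?case
  proof (cases "L = carrier R")
    case True
    then show ?thesis using step.prems(5) ideal_subset[OF step.prems(3)] by (metis subset_antisym)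
  next
    case False
    note L = step.hyps
    obtain a where a: "a \<in> carrier R" "primeideal (colon L a) R" "colon L a \<in> assoc_primes L"
      using exists_assoc_prime[OF L False] unfolding assoc_primes_def by auto
    have aL: "a \<notin> L" using prime_one[OF a(2)] a(1) unfolding colon_def by auto
    \<comment> \<open>As \<open>L\<close> is saturated, nothing outside \<open>P\<close> annihilates
      the class of \<open>a\<close>; minimality of \<open>P\<close> over \<open>L\<close> then gives
      \<open>colon L a = P\<close>. So \<open>M / L\<close> becomes the residue field after
      localizing at \<open>P\<close>, a single composition factor.\<close>
    have "colon L a \<subseteq> P" using saturatedD[OF step.prems(1)] aL a(1) unfolding colon_def by auto
    then have P_eq: "colon L a = P" using step.prems(2) a(2) assoc_prime_contains[OF L a(3)] by auto
    define M where "M = saturation P (adj L a)"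
    have adjL: "ideal (adj L a) R" by (rule adj_ideal[OF L a(1)])
    have M: "ideal M R" "saturated P M"
      unfolding M_def using saturation_ideal[OF P adjL] saturated_saturation[OF P adjL] by auto
    have LM: "L \<subset> M"
      unfolding M_def using subset_saturation[OF P adjL] subset_adj[OF L a(1)] self_in_adj[OF L a(1)] aL
      by auto
    have minM: "Q = P" if "primeideal Q R" "M \<subseteq> Q" "Q \<subseteq> P" for Q
      using step.prems(2)[OF that(1) _ that(3)] that(2) LM by auto
    \<comment> \<open>Either the whole chain lies above \<open>M\<close>, or its members from some
      \<open>j\<close> on miss \<open>a\<close>. In the second case the sums with \<open>M\<close>
      stabilize by induction. A multiple \<open>r \<otimes> a\<close> in such a member has
      \<open>r \<in> P\<close>, hence lies in \<open>L\<close>, so equality of the sums descends to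
      the chain itself.\<close>
    show ?thesis
    proof (cases "\<forall>i. a \<in> K i")
      case True
      have "M \<subseteq> K i" for i
        unfolding M_def using True step.prems(3,4,5)
        by (intro saturation_minimal adj_minimal[OF L a(1)]) auto
      then show ?thesis using step.IH[OF M(1) LM M(2) minM, of K] step.prems by auto
    next
      case False
      then obtain j where j: "a \<notin> K j" by auto
      have dec: "K (j + i) \<subseteq> K j" for i
        by (induction i) (use step.prems(6) in auto)
      let ?K = "\<lambda>i. saturation P (adj (K (j + i)) a)"
      have Ki: "ideal (adj (K (j + i)) a) R" for i using adj_ideal[OF step.prems(3) a(1)] .
      have "\<exists>n. ?K (Suc n) = ?K n"
      proof (rule step.IH[OF M(1) LM M(2) minM])
        fix i
        show "ideal (?K i) R" "saturated P (?K i)"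
          using saturation_ideal[OF P Ki] saturated_saturation[OF P Ki] by auto
        show "M \<subseteq> ?K i" unfolding M_def using step.prems(5) by (intro saturation_mono adj_mono)
        show "?K (Suc i) \<subseteq> ?K i" using step.prems(6) by (intro saturation_mono adj_mono) auto
      qed
      then obtain n where n: "?K (Suc n) = ?K n" ..
      note K' = step.prems(3)[of "j + n"] step.prems(3)[of "j + Suc n"]
      have "K (j + n) \<subseteq> K (j + Suc n)"
      proof
        fix b assume b: "b \<in> K (j + n)"
        then have bc: "b \<in> carrier R" using ideal_carrier[OF K'(1)] by auto
        have "b \<in> ?K (Suc n)"
          unfolding n using b subset_saturation[OF P Ki] subset_adj[OF K'(1) a(1)] by blast
        then obtain s c r where s: "s \<in> carrier R" "s \<notin> P" "c \<in> K (j + Suc n)" "r \<in> carrier R"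
          "s \<otimes> b = c \<oplus> r \<otimes> a"
          unfolding saturation_def by (auto elim!: adjE)
        have "c \<in> K (j + n)" using s(3) step.prems(6)[of "j + n"] by auto
        then have "r \<otimes> a \<in> K (j + n)"
          using ideal_add_cancel[OF K'(1), of c "r \<otimes> a"] ideal_lmult[OF K'(1) s(1) b] s a by auto
        then have "r \<in> P"
          using saturatedD[OF step.prems(4) s(4) _ a(1)] dec j by blast
        then have "r \<otimes> a \<in> K (j + Suc n)" using P_eq step.prems(5) unfolding colon_def by auto
        then have "s \<otimes> b \<in> K (j + Suc n)" using s ideal_add[OF K'(2)] by auto
        then show "b \<in> K (j + Suc n)" using saturatedD[OF step.prems(4) s(1,2) bc] by blast
      qed
      then show ?thesis using step.prems(6)[of "j + n"] by (intro exI[of _ "j + n"]) auto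
    qed
  qed
qed

text \<open>By \<open>gen\<close>, multiplication by \<open>x\<close> maps the localization of
  \<open>M / N\<close> onto itself. For a saturated \<open>N'\<close> maximal strictly below
  \<open>M\<close>, the ideal \<open>M\<close> is generated over \<open>N'\<close> by one
  \<open>b\<close>, up to saturation. Expressing \<open>b\<close> through itself yields
  \<open>t \<otimes> s \<ominus> x \<otimes> r\<close>, which is outside \<open>P\<close> because
  \<open>x \<in> P\<close>, and which sends \<open>b\<close> into \<open>N'\<close>.\<close>

lemma nakayama_saturated:
  assumes P: "primeideal P R" and x: "x \<in> P"
    and N: "ideal N R" "saturated P N" and M: "ideal M R" "saturated P M" and NM: "N \<subseteq> M"
    and gen: "\<And>m. m \<in> M \<Longrightarrow> \<exists>s\<in>carrier R - P. \<exists>n\<in>N. \<exists>m'\<in>M. s \<otimes> m = n \<oplus> m' \<otimes> x"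
  shows "N = M"
proof (rule ccontr)
  assume "N \<noteq> M"
  let ?F = "{N'. ideal N' R \<and> saturated P N' \<and> N \<subseteq> N' \<and> N' \<subset> M}"
  have "?F \<noteq> {}" using N NM \<open>N \<noteq> M\<close> by auto
  then have "\<exists>M\<in>?F. \<forall>X\<in>?F. M \<subseteq> X \<longrightarrow> X = M" by (rule exists_maximal_ideal_in) blast
  then obtain N' where N'F: "N' \<in> ?F" and max: "\<forall>X\<in>?F. N' \<subseteq> X \<longrightarrow> X = N'" by (rule bexE)
  have N': "ideal N' R" "saturated P N'" "N \<subseteq> N'" "N' \<subset> M" using N'F by auto
  obtain b where b: "b \<in> M" "b \<notin> N'" using N' by auto
  have bc: "b \<in> carrier R" and xc: "x \<in> carrier R"
    using b x ideal_carrier[OF M(1)] ideal_carrier[OF prime_ideal[OF P]] by auto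
  have adjN: "ideal (adj N' b) R" by (rule adj_ideal[OF N'(1) bc])
  have sub: "adj N' b \<subseteq> saturation P (adj N' b)" by (rule subset_saturation[OF P adjN])
  have "saturation P (adj N' b) \<subseteq> M"
    using N' b by (intro saturation_minimal M adj_minimal[OF N'(1) bc]) auto
  moreover have "N' \<subseteq> saturation P (adj N' b)" "b \<in> saturation P (adj N' b)"
    using sub subset_adj[OF N'(1) bc] self_in_adj[OF N'(1) bc] by auto
  ultimately have M_eq: "saturation P (adj N' b) = M"
    using max saturation_ideal[OF P adjN] saturated_saturation[OF P adjN] N' b by blast
  obtain s n m where s: "s \<in> carrier R" "s \<notin> P" "n \<in> N" "m \<in> M" "s \<otimes> b = n \<oplus> m \<otimes> x"
    using gen[OF b(1)] by auto
  obtain t l r where t: "t \<in> carrier R" "t \<notin> P" "l \<in> N'" "r \<in> carrier R" "t \<otimes> m = l \<oplus> r \<otimes> b"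
    using s(4) unfolding M_eq[symmetric] saturation_def by (auto elim!: adjE)
  have c: "n \<in> carrier R" "l \<in> carrier R" "m \<in> carrier R"
    using s t ideal_carrier N M N' by auto
  let ?u = "t \<otimes> s \<ominus> x \<otimes> r"
  have "t \<otimes> (s \<otimes> b) = t \<otimes> n \<oplus> x \<otimes> (t \<otimes> m)" unfolding s(5) using s(1) t(1) c xc by algebra
  also have "\<dots> = (t \<otimes> n \<oplus> x \<otimes> l) \<oplus> (x \<otimes> r) \<otimes> b" unfolding t(5) using t(1,4) c xc bc by algebra
  finally have e: "t \<otimes> (s \<otimes> b) = (t \<otimes> n \<oplus> x \<otimes> l) \<oplus> (x \<otimes> r) \<otimes> b" .
  have "?u \<otimes> b = t \<otimes> (s \<otimes> b) \<ominus> (x \<otimes> r) \<otimes> b" using s(1) t(1,4) xc bc by algebra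
  also have "\<dots> = t \<otimes> n \<oplus> x \<otimes> l" unfolding e using t(1,4) c xc bc by algebra
  also have "\<dots> \<in> N'" using s t xc N' by (intro ideal_add[OF N'(1)] ideal_lmult[OF N'(1)]) auto
  finally have "?u \<otimes> b \<in> N'" .
  moreover have "?u \<notin> P"
  proof
    assume "?u \<in> P"
    moreover have "x \<otimes> r \<in> P" using x t ideal_rmult[OF prime_ideal[OF P]] by auto
    moreover have "t \<otimes> s = ?u \<oplus> x \<otimes> r" using s(1) t(1,4) xc by algebra
    ultimately have "t \<otimes> s \<in> P" using ideal_add[OF prime_ideal[OF P]] by metis
    then show False using prime_mult[OF P] s t by auto
  qed
  moreover have "?u \<in> carrier R" using s(1) t(1,4) xc by simp
  ultimately have "b \<in> N'" using saturatedD[OF N'(2) _ _ bc] by blast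
  then show False using b by auto
qed

text \<open>Krull's principal ideal theorem for \<open>R / Q0\<close>. The artinian ring is \<open>(R / (Q0, x))\<^sub>P\<close>, and the ideals
  \<open>J i\<close> are the contractions of \<open>q\<^sup>i (R / Q0)\<^sub>Q\<close> for some \<open>q \<in> Q - Q0\<close>.\<close>

lemma principal_ideal_theorem:
  assumes pr: "primeideal Q0 R" "primeideal Q R" "primeideal P R"
    and sub: "Q0 \<subset> Q" "Q \<subset> P" and x: "x \<in> P"
    and min: "\<And>Q'. primeideal Q' R \<Longrightarrow> Q0 \<subseteq> Q' \<Longrightarrow> x \<in> Q' \<Longrightarrow> Q' \<subseteq> P \<Longrightarrow> Q' = P"
  shows False
proof -
  note id = prime_ideal[OF pr(1)] prime_ideal[OF pr(2)] prime_ideal[OF pr(3)]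
  have xQ: "x \<notin> Q" using min[OF pr(2)] sub by auto
  obtain q where q: "q \<in> Q" "q \<notin> Q0" using sub by auto
  have c: "q \<in> carrier R" "x \<in> carrier R" using q x ideal_carrier id by auto
  define J where "J i = saturation Q (adj Q0 (q [^] i))" for i :: nat
  have adjJ: "ideal (adj Q0 (q [^] i)) R" for i :: nat using adj_ideal[OF id(1)] c by auto
  have J: "ideal (J i) R" "saturated Q (J i)" "Q0 \<subseteq> J i" for i
    unfolding J_def using saturation_ideal[OF pr(2) adjJ] saturated_saturation[OF pr(2) adjJ]
      subset_saturation[OF pr(2) adjJ] subset_adj[OF id(1) nat_pow_closed[OF c(1)]] by blast+
  have JP: "saturated P (J i)" for i using J(2) saturated_antimono sub by blast
  have Jdec: "J (Suc i) \<subseteq> J i" for i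
  proof -
    have "q \<otimes> q [^] i \<in> adj Q0 (q [^] i)"
      using ideal_lmult[OF adjJ[of i]] self_in_adj[OF id(1)] c by auto
    then have "q [^] Suc i \<in> adj Q0 (q [^] i)" using c by (simp add: m_comm)
    then have "adj Q0 (q [^] Suc i) \<subseteq> adj Q0 (q [^] i)"
      using c by (intro adj_minimal[OF id(1) _ adjJ] subset_adj[OF id(1)]) auto
    then show ?thesis unfolding J_def by (rule saturation_mono)
  qed
  define L where "L = saturation P (adj Q0 x)"
  have adjL: "ideal (adj Q0 x) R" using adj_ideal[OF id(1)] c by auto
  have L: "ideal L R" "saturated P L" "adj Q0 x \<subseteq> L"
    unfolding L_def using saturation_ideal[OF pr(3) adjL] saturated_saturation[OF pr(3) adjL]
      subset_saturation[OF pr(3) adjL] by auto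
  define K where "K i = saturation P (adj (J i) x)" for i
  have adjK: "ideal (adj (J i) x) R" for i using adj_ideal[OF J(1) c(2)] .
  have "\<exists>n. K (Suc n) = K n"
  proof (rule descending_chain_stabilizes[OF pr(3) L(1,2)])
    fix Q' assume "primeideal Q' R" "L \<subseteq> Q'" "Q' \<subseteq> P"
    then show "Q' = P"
      using min[of Q'] L(3) subset_adj[OF id(1) c(2)] self_in_adj[OF id(1) c(2)] by blast
  next
    fix i
    show "ideal (K i) R" "saturated P (K i)"
      unfolding K_def using saturation_ideal[OF pr(3) adjK] saturated_saturation[OF pr(3) adjK] by auto
    show "L \<subseteq> K i" unfolding L_def K_def using J(3) by (intro saturation_mono adj_mono)
    show "K (Suc i) \<subseteq> K i" unfolding K_def using Jdec by (intro saturation_mono adj_mono)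
  qed
  then obtain n where n: "K (Suc n) = K n" ..
  \<comment> \<open>Locally at \<open>P\<close>, an element of \<open>J n\<close> is an element of
    \<open>J (Suc n)\<close> plus a multiple of \<open>x\<close>. That multiple lies in
    \<open>J n\<close>, and so does its coefficient, since \<open>J n\<close> is
    \<open>Q\<close>-saturated and \<open>x \<notin> Q\<close>. This is the hypothesis of Nakayama's
    lemma.\<close>
  have "J (Suc n) = J n"
  proof (rule nakayama_saturated[OF pr(3) x J(1) JP J(1) JP Jdec])
    fix a assume a: "a \<in> J n"
    have "a \<in> K (Suc n)"
      unfolding n unfolding K_def using a subset_saturation[OF pr(3) adjK] subset_adj[OF J(1) c(2)] by blast
    then obtain s b r where s: "s \<in> carrier R" "s \<notin> P" "b \<in> J (Suc n)" "r \<in> carrier R"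
      "s \<otimes> a = b \<oplus> r \<otimes> x"
      unfolding K_def saturation_def by (auto elim!: adjE)
    have "r \<otimes> x \<in> J n"
      using ideal_add_cancel[OF J(1), of b "r \<otimes> x" n] ideal_lmult[OF J(1) s(1) a] s c Jdec by auto
    then have "r \<in> J n" using saturatedD[OF J(2) c(2) xQ s(4)] s c by (simp add: m_comm)
    then show "\<exists>s\<in>carrier R - P. \<exists>b\<in>J (Suc n). \<exists>r\<in>J n. s \<otimes> a = b \<oplus> r \<otimes> x" using s by blast
  qed
  moreover have "q [^] n \<in> J n"
    unfolding J_def using subset_saturation[OF pr(2) adjJ] self_in_adj[OF id(1)] c by blast
  ultimately have "q [^] n \<in> J (Suc n)" by simp
  then obtain s z r where s: "s \<in> carrier R" "s \<notin> Q" "z \<in> Q0" "r \<in> carrier R"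
    "s \<otimes> q [^] n = z \<oplus> r \<otimes> q [^] Suc n"
    unfolding J_def saturation_def by (auto elim!: adjE)
  have zc: "z \<in> carrier R" using s ideal_carrier[OF id(1)] by auto
  have qn: "q [^] n \<in> carrier R" using c by auto
  have s5: "s \<otimes> q [^] n = z \<oplus> r \<otimes> (q [^] n \<otimes> q)" using s(5) by simp
  \<comment> \<open>In the domain \<open>R / Q0\<close> the power of \<open>q\<close> cancels,
    leaving \<open>s\<close> congruent to \<open>r \<otimes> q\<close>. But \<open>s\<close> is
    outside \<open>Q\<close>, while \<open>r \<otimes> q\<close> and \<open>Q0\<close> are
    inside.\<close>
  have "(s \<ominus> r \<otimes> q) \<otimes> q [^] n = s \<otimes> q [^] n \<ominus> r \<otimes> (q [^] n \<otimes> q)"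
    using s(1,4) c(1) qn by algebra
  also have "\<dots> = z" unfolding s5 using zc s(4) c(1) qn by algebra
  finally have "(s \<ominus> r \<otimes> q) \<otimes> q [^] n \<in> Q0" using s(3) by simp
  then have "s \<ominus> r \<otimes> q \<in> Q0"
    using prime_mult[OF pr(1), of "s \<ominus> r \<otimes> q" "q [^] n"] prime_pow[OF pr(1) c(1)] q(2) s c by auto
  then have "s \<ominus> r \<otimes> q \<oplus> r \<otimes> q \<in> Q"
    using sub q ideal_add[OF id(2)] ideal_lmult[OF id(2) s(4)] by auto
  moreover have "s \<ominus> r \<otimes> q \<oplus> r \<otimes> q = s" using s(1,4) c by algebra
  ultimately show False using s by simp
qed

end

section \<open>Regular sequences over an ideal\<close>

context cring
begin

text \<open>A weakly regular sequence on \<open>R / J\<close>: the last quotient may vanish. Keeping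
  \<open>J\<close> as a parameter allows a sequence to be cut anywhere and a nonzerodivisor
  \<open>z\<close> to be put in front by replacing \<open>J\<close> with
  \<open>adj J z\<close>.\<close>

primrec regular_over :: "'a set \<Rightarrow> 'a list \<Rightarrow> bool"
  where "regular_over J [] \<longleftrightarrow> True"
  | "regular_over J (x # xs) \<longleftrightarrow> nzd J x \<and> regular_over (adj J x) xs"

definition adjoin :: "'a set \<Rightarrow> 'a list \<Rightarrow> 'a set"
  where "adjoin J xs = foldl adj J xs"

lemma adjoin_simps [simp]:
  "adjoin J [] = J" "adjoin J (x # xs) = adjoin (adj J x) xs" "adjoin J (xs @ [x]) = adj (adjoin J xs) x"
  unfolding adjoin_def by simp_all

lemma regular_over_append:
  "regular_over J (xs @ ys) \<longleftrightarrow> regular_over J xs \<and> regular_over (adjoin J xs) ys"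
  by (induction xs arbitrary: J) auto

lemma adjoin_ideal: "ideal J R \<Longrightarrow> set xs \<subseteq> carrier R \<Longrightarrow> ideal (adjoin J xs) R"
  by (induction xs arbitrary: J) (auto simp: adj_ideal)

lemma subset_adjoin: "ideal J R \<Longrightarrow> set xs \<subseteq> carrier R \<Longrightarrow> J \<subseteq> adjoin J xs"
proof (induction xs arbitrary: J)
  case (Cons x xs)
  then show ?case using subset_adj[of J x] Cons.IH[of "adj J x"] adj_ideal[of J x] by auto
qed simp

lemma set_adjoin: "ideal J R \<Longrightarrow> set xs \<subseteq> carrier R \<Longrightarrow> set xs \<subseteq> adjoin J xs"
proof (induction xs arbitrary: J)
  case (Cons x xs)
  then show ?case
    using self_in_adj[of J x] subset_adjoin[of "adj J x" xs] Cons.IH[of "adj J x"] adj_ideal[of J x] by auto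
qed simp

lemma adjoin_minimal: "ideal J R \<Longrightarrow> ideal M R \<Longrightarrow> J \<subseteq> M \<Longrightarrow> set xs \<subseteq> M \<Longrightarrow> adjoin J xs \<subseteq> M"
proof (induction xs arbitrary: J)
  case (Cons x xs)
  have x: "x \<in> carrier R" using Cons.prems ideal_carrier by auto
  show ?case
    using Cons.prems adj_minimal[OF Cons.prems(1) x Cons.prems(2)]
      Cons.IH[OF adj_ideal[OF Cons.prems(1) x] Cons.prems(2)] by auto
qed simp

lemma regular_over_carrier: "regular_over J xs \<Longrightarrow> set xs \<subseteq> carrier R"
  by (induction xs arbitrary: J) (auto simp: nzd_def)

end

section \<open>Krull's theorem for several generators, and chains of primes from regular
  sequences\<close>

context noetherian_cring
begin

text \<open>An ideal \<open>M\<close> maximal among those containing \<open>I\<close> and missing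
  \<open>S\<close> is prime: if \<open>a\<close> and \<open>b\<close> are outside,
  \<open>adj M a\<close> and \<open>adj M b\<close> both meet \<open>S\<close>, and the product of
  the two common elements lies in \<open>M\<close> as soon as \<open>a \<otimes> b\<close>
  does.\<close>

lemma prime_disjoint_from_multiplicative:
  assumes I: "ideal I R" and S: "S \<subseteq> carrier R" "\<one> \<in> S" "\<And>s t. s \<in> S \<Longrightarrow> t \<in> S \<Longrightarrow> s \<otimes> t \<in> S"
    and disj: "I \<inter> S = {}"
  obtains Q where "primeideal Q R" "I \<subseteq> Q" "Q \<inter> S = {}"
proof -
  let ?F = "{J. ideal J R \<and> I \<subseteq> J \<and> J \<inter> S = {}}"
  have "?F \<noteq> {}" using I disj by auto
  then have "\<exists>M\<in>?F. \<forall>X\<in>?F. M \<subseteq> X \<longrightarrow> X = M" by (rule exists_maximal_ideal_in) blast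
  then obtain M where MF: "M \<in> ?F" and max: "\<forall>X\<in>?F. M \<subseteq> X \<longrightarrow> X = M" by (rule bexE)
  have M: "ideal M R" "I \<subseteq> M" "M \<inter> S = {}" using MF by auto
  have meets: "\<exists>m\<in>M. \<exists>r\<in>carrier R. m \<oplus> r \<otimes> a \<in> S" if a: "a \<in> carrier R" "a \<notin> M" for a
  proof -
    have "adj M a \<noteq> M" using self_in_adj[OF M(1) a(1)] a by auto
    then have "adj M a \<inter> S \<noteq> {}"
      using max adj_ideal[OF M(1) a(1)] subset_adj[OF M(1) a(1)] M(2) by blast
    then show ?thesis by (auto elim!: adjE)
  qed
  have "primeideal M R"
  proof (rule primeI[OF M(1)])
    show "\<one> \<notin> M" using M S by auto
    fix a b assume ab: "a \<in> carrier R" "b \<in> carrier R" "a \<otimes> b \<in> M" "a \<notin> M"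
    show "b \<in> M"
    proof (rule ccontr)
      assume "b \<notin> M"
      then obtain n t where n: "n \<in> M" "t \<in> carrier R" "n \<oplus> t \<otimes> b \<in> S" using meets ab by blast
      obtain m r where m: "m \<in> M" "r \<in> carrier R" "m \<oplus> r \<otimes> a \<in> S" using meets ab by blast
      have c: "m \<in> carrier R" "n \<in> carrier R" using m n ideal_carrier[OF M(1)] by auto
      have "(m \<oplus> r \<otimes> a) \<otimes> (n \<oplus> t \<otimes> b) = (n \<oplus> t \<otimes> b) \<otimes> m \<oplus> ((r \<otimes> a) \<otimes> n \<oplus> (r \<otimes> t) \<otimes> (a \<otimes> b))"
        using m(2) n(2) ab c by algebra
      also have "\<dots> \<in> M"
        using m(1,2) n(1,2) ab(1,2) c ideal_lmult[OF M(1) _ ab(3), of "r \<otimes> t"]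
          ideal_lmult[OF M(1) _ m(1), of "n \<oplus> t \<otimes> b"] ideal_lmult[OF M(1) _ n(1), of "r \<otimes> a"]
        by (intro ideal_add[OF M(1)]) auto
      finally show False using S(3)[OF m(3) n(3)] M(3) by auto
    qed
  qed
  then show ?thesis using that M by blast
qed

text \<open>In the localization at \<open>P\<close>, an element of all primes above \<open>I\<close>
  is nilpotent modulo \<open>I\<close>. Otherwise some prime above \<open>I\<close> misses all
  products \<open>s \<otimes> w [^] n\<close>; the exponent 0 puts that prime inside
  \<open>P\<close>, and \<open>s = \<one>\<close> with exponent 1 keeps \<open>w\<close> out of
  it.\<close>

lemma power_in_of_all_primes:
  assumes P: "primeideal P R" and I: "ideal I R" and w: "w \<in> carrier R"
    and all: "\<And>Q. primeideal Q R \<Longrightarrow> I \<subseteq> Q \<Longrightarrow> Q \<subseteq> P \<Longrightarrow> w \<in> Q"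
  obtains s and n :: nat where "s \<in> carrier R" "s \<notin> P" "s \<otimes> w [^] n \<in> I"
proof (cases "\<exists>s\<in>carrier R - P. \<exists>n::nat. s \<otimes> w [^] n \<in> I")
  case True
  then show ?thesis using that by auto
next
  case False
  let ?S = "{s \<otimes> w [^] n | s n. s \<in> carrier R - P \<and> n \<in> (UNIV :: nat set)}"
  have in_S: "s \<otimes> w [^] n \<in> ?S" if "s \<in> carrier R" "s \<notin> P" for s and n :: nat using that by auto
  note one = in_S[OF one_closed prime_one[OF P], of 0] in_S[OF one_closed prime_one[OF P], of "Suc 0"]
  have mult: "a \<otimes> b \<in> ?S" if "a \<in> ?S" "b \<in> ?S" for a b
  proof -
    obtain s and m :: nat where s: "a = s \<otimes> w [^] m" "s \<in> carrier R" "s \<notin> P"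
      using \<open>a \<in> ?S\<close> by auto
    obtain t and n :: nat where t: "b = t \<otimes> w [^] n" "t \<in> carrier R" "t \<notin> P"
      using \<open>b \<in> ?S\<close> by auto
    have st: "s \<otimes> t \<notin> P" using prime_mult[OF P] s t by auto
    have "a \<otimes> b = (s \<otimes> t) \<otimes> (w [^] m \<otimes> w [^] n)"
      unfolding s(1) t(1) using s(2) t(2) nat_pow_closed[OF w] by (simp add: m_ac)
    also have "\<dots> = (s \<otimes> t) \<otimes> w [^] (m + n)" using nat_pow_mult[OF w] by simp
    finally show ?thesis using in_S[OF _ st] s t by auto
  qed
  have "I \<inter> ?S = {}" using False by blast
  moreover have "?S \<subseteq> carrier R" using w by auto
  moreover have "\<one> \<in> ?S" using one(1) w by simp
  ultimately obtain Q where Q: "primeideal Q R" "I \<subseteq> Q" "Q \<inter> ?S = {}"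
    using prime_disjoint_from_multiplicative[OF I, of ?S] mult by blast
  have "Q \<subseteq> P"
  proof
    fix s assume s: "s \<in> Q"
    then have sc: "s \<in> carrier R" using ideal_carrier[OF prime_ideal[OF Q(1)]] by auto
    then show "s \<in> P" using in_S[OF sc, of 0] s Q(3) by auto
  qed
  then have "w \<in> Q" using all Q by auto
  moreover have "w \<in> ?S" using one(2) w by simp
  ultimately show ?thesis using Q(3) by blast
qed

definition prime_chain :: "(nat \<Rightarrow> 'a set) \<Rightarrow> nat \<Rightarrow> 'a set \<Rightarrow> bool"
  where "prime_chain p k P \<longleftrightarrow>
    (\<forall>i\<le>k. primeideal (p i) R) \<and> (\<forall>i<k. p i \<subset> p (Suc i)) \<and> p k = P"

text \<open>Induction on the length of the chain, giving up one generator per step. For a prime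
  \<open>Q\<close> directly below \<open>P\<close> and a generator \<open>x\<close> outside
  \<open>Q\<close>, \<open>P\<close> is the only prime between \<open>adj Q x\<close> and
  \<open>P\<close>. So some power of each other generator \<open>w\<close> is, up to a factor
  outside \<open>P\<close>, congruent modulo \<open>x\<close> to an element \<open>z w\<close> of
  \<open>Q\<close>, and these elements cut out \<open>Q\<close>.\<close>

theorem krull_height:
  assumes "finite X" "primeideal P R" "X \<subseteq> P" "prime_chain p k P"
    and "\<And>Q. primeideal Q R \<Longrightarrow> X \<subseteq> Q \<Longrightarrow> Q \<subseteq> P \<Longrightarrow> Q = P"
  shows "k \<le> card X"
  using assms
proof (induction k arbitrary: X P p)
  case 0
  then show ?case by simp
next
  case (Suc k)
  note P = Suc.prems(2) and min = Suc.prems(5)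
  have p: "primeideal (p i) R" if "i \<le> k" for i using Suc.prems(4) that unfolding prime_chain_def by auto
  have pk: "p k \<subset> P" using Suc.prems(4) unfolding prime_chain_def by auto
  let ?F = "{Q. primeideal Q R \<and> p k \<subseteq> Q \<and> Q \<subset> P}"
  have "?F \<noteq> {}" using p[of k] pk by auto
  then have "\<exists>M\<in>?F. \<forall>Y\<in>?F. M \<subseteq> Y \<longrightarrow> Y = M"
    by (rule exists_maximal_ideal_in) (use prime_ideal in blast)
  then obtain Q where QF: "Q \<in> ?F" and max: "\<forall>Y\<in>?F. Q \<subseteq> Y \<longrightarrow> Y = Q" by (rule bexE)
  have Q: "primeideal Q R" "p k \<subseteq> Q" "Q \<subset> P" using QF by auto
  note idQ = prime_ideal[OF Q(1)]
  obtain x where x: "x \<in> X" "x \<notin> Q" using min[OF Q(1)] Q(3) by auto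
  have Xc: "w \<in> carrier R" if "w \<in> X" for w
    using that Suc.prems(3) ideal_carrier[OF prime_ideal[OF P]] by auto
  note xc = Xc[OF x(1)]
  have Qx: "Q' = P" if "primeideal Q' R" "adj Q x \<subseteq> Q'" "Q' \<subseteq> P" for Q'
  proof (rule ccontr)
    assume "Q' \<noteq> P"
    then have "Q' \<in> ?F" "Q \<subseteq> Q'" using that subset_adj[OF idQ xc] Q(2) by auto
    then have "Q' = Q" using max by simp
    then show False using x(2) that(2) self_in_adj[OF idQ xc] by auto
  qed
  have "\<exists>z. \<exists>r\<in>carrier R. \<exists>s\<in>carrier R - P. \<exists>n::nat. z \<in> Q \<and> s \<otimes> w [^] n = z \<oplus> r \<otimes> x" if "w \<in> X" for w
  proof -
    have "w \<in> Q'" if "primeideal Q' R" "adj Q x \<subseteq> Q'" "Q' \<subseteq> P" for Q'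
      using Qx[OF that] \<open>w \<in> X\<close> Suc.prems(3) by auto
    from power_in_of_all_primes[OF P adj_ideal[OF idQ xc] Xc[OF that] this]
    obtain s and n :: nat where s: "s \<in> carrier R" "s \<notin> P" "s \<otimes> w [^] n \<in> adj Q x" .
    from s(3) obtain z r where "z \<in> Q" "r \<in> carrier R" "s \<otimes> w [^] n = z \<oplus> r \<otimes> x" by (rule adjE)
    then show ?thesis using s by blast
  qed
  then have "\<forall>w\<in>X. \<exists>z. \<exists>r\<in>carrier R. \<exists>s\<in>carrier R - P. \<exists>n::nat. z \<in> Q \<and> s \<otimes> w [^] n = z \<oplus> r \<otimes> x"
    by blast
  from bchoice[OF this] obtain z where z: "\<And>w. w \<in> X \<Longrightarrow>
    \<exists>r\<in>carrier R. \<exists>s\<in>carrier R - P. \<exists>n::nat. z w \<in> Q \<and> s \<otimes> w [^] n = z w \<oplus> r \<otimes> x"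
    by blast
  \<comment> \<open>Suppose a prime \<open>Q'\<close> strictly inside \<open>Q\<close> contains the
    elements \<open>z w\<close>. A prime between \<open>Q'\<close> and \<open>P\<close> that
    contains \<open>x\<close> then contains powers of all generators, hence \<open>X\<close>, hence
    equals \<open>P\<close>. The chain from \<open>Q'\<close> through \<open>Q\<close> to
    \<open>P\<close> now contradicts the principal ideal theorem.\<close>
  have minQ: "Q' = Q" if Q': "primeideal Q' R" "z ` (X - {x}) \<subseteq> Q'" "Q' \<subseteq> Q" for Q'
  proof (rule ccontr)
    assume "Q' \<noteq> Q"
    then have "Q' \<subset> Q" using Q' by auto
    moreover have "Q'' = P" if Q'': "primeideal Q'' R" "Q' \<subseteq> Q''" "x \<in> Q''" "Q'' \<subseteq> P" for Q''
    proof (rule min[OF Q''(1) _ Q''(4)])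
      note id = prime_ideal[OF Q''(1)]
      show "X \<subseteq> Q''"
      proof
        fix w assume w: "w \<in> X"
        show "w \<in> Q''"
        proof (cases "w = x")
          case False
          obtain r s n where r: "r \<in> carrier R" "s \<in> carrier R" "s \<notin> P" "s \<otimes> w [^] (n::nat) = z w \<oplus> r \<otimes> x"
            using z[OF w] by auto
          have "z w \<in> Q''" using w False Q' Q'' by auto
          then have "s \<otimes> w [^] n \<in> Q''" unfolding r(4) using Q'' r by (intro ideal_add[OF id] ideal_lmult[OF id])
          then have "w [^] n \<in> Q''" using prime_mult[OF Q''(1) r(2) nat_pow_closed[OF Xc[OF w]]] r(3) Q''(4) by blast
          then show ?thesis using prime_pow[OF Q''(1) Xc[OF w]] by auto
        qed (use Q'' in auto)
      qed
    qed
    ultimately show False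
      using principal_ideal_theorem[OF Q'(1) Q(1) P _ Q(3), of x] x Suc.prems(3) by blast
  qed
  \<comment> \<open>The chain for the induction has only its top member \<open>p k\<close> enlarged
    to \<open>Q\<close>, so the member below it needs a new comparison.\<close>
  have "p i \<subset> Q" if "Suc i = k" for i
    using Suc.prems(4) Q(2) that unfolding prime_chain_def by (metis lessI less_SucI order_less_le_trans)
  then have "prime_chain (p(k := Q)) k Q"
    using Suc.prems(4) Q(1) unfolding prime_chain_def by auto
  moreover have "z ` (X - {x}) \<subseteq> Q" using z by blast
  ultimately have "k \<le> card (z ` (X - {x}))"
    using Suc.prems(1) Q(1) minQ by (intro Suc.IH) auto
  also have "\<dots> \<le> card (X - {x})" using Suc.prems(1) by (intro card_image_le) auto
  also have "\<dots> < card X" using Suc.prems(1) x(1) by (intro psubset_card_mono) auto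
  finally show ?case by simp
qed

lemma nzd_pow:
  fixes n :: nat
  assumes "nzd I x" "y \<in> carrier R" "y \<otimes> x [^] n \<in> I"
  shows "y \<in> I"
  using assms(2,3)
proof (induction n arbitrary: y)
  case (Suc n)
  have x: "x \<in> carrier R" using assms(1) unfolding nzd_def by auto
  have "x \<otimes> (y \<otimes> x [^] n) \<in> I" using Suc.prems x by (simp add: m_ac)
  then have "y \<otimes> x [^] n \<in> I" using assms(1) Suc.prems x unfolding nzd_def by auto
  then show ?case using Suc by auto
qed simp

text \<open>If \<open>x\<close> were in every prime between \<open>I\<close> and \<open>Q\<close>,
  then \<open>s \<otimes> x [^] n \<in> I\<close> for some \<open>s\<close> outside
  \<open>Q\<close>; cancelling \<open>x\<close> puts \<open>s\<close> into \<open>I\<close>, hence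
  into \<open>Q\<close>.\<close>

lemma nzd_smaller_prime:
  assumes I: "ideal I R" and x: "nzd I x" and Q: "primeideal Q R" and sub: "I \<subseteq> Q"
  obtains Q' where "primeideal Q' R" "I \<subseteq> Q'" "Q' \<subseteq> Q" "x \<notin> Q'"
proof (rule ccontr)
  assume "\<not> thesis"
  then have "\<And>Q'. primeideal Q' R \<Longrightarrow> I \<subseteq> Q' \<Longrightarrow> Q' \<subseteq> Q \<Longrightarrow> x \<in> Q'" using that by blast
  from power_in_of_all_primes[OF Q I _ this] x obtain s and n :: nat where
    "s \<in> carrier R" "s \<notin> Q" "s \<otimes> x [^] n \<in> I" unfolding nzd_def by blast
  then show False using nzd_pow[OF x] sub by auto
qed

text \<open>The inequality between depth and height. The last term of the sequence is missed by a
  smaller prime that still contains \<open>J\<close> and the earlier terms, so each term contributes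
  one step of the chain.\<close>

lemma regular_sequence_prime_chain:
  assumes J: "ideal J R" and "regular_over J xs" "primeideal Q R" "J \<subseteq> Q" "set xs \<subseteq> Q"
  shows "\<exists>p. prime_chain p (length xs) Q"
  using assms(2-)
proof (induction xs arbitrary: Q rule: rev_induct)
  case Nil
  then show ?case unfolding prime_chain_def by (intro exI[of _ "\<lambda>_. Q"]) auto
next
  case (snoc x xs)
  have reg: "regular_over J xs" "nzd (adjoin J xs) x" using snoc.prems by (auto simp: regular_over_append)
  note xs = regular_over_carrier[OF reg(1)]
  note I = adjoin_ideal[OF J xs]
  have "adjoin J xs \<subseteq> Q"
    using adjoin_minimal[OF J prime_ideal[OF snoc.prems(2)]] snoc.prems by auto
  then obtain Q' where Q': "primeideal Q' R" "adjoin J xs \<subseteq> Q'" "Q' \<subseteq> Q" "x \<notin> Q'"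
    by (rule nzd_smaller_prime[OF I reg(2) snoc.prems(2)])
  have "J \<subseteq> Q'" "set xs \<subseteq> Q'" using Q' subset_adjoin[OF J xs] set_adjoin[OF J xs] by auto
  then obtain p where p: "prime_chain p (length xs) Q'" using snoc.IH[OF reg(1) Q'(1)] by auto
  have "Q' \<subset> Q" using Q' snoc.prems by auto
  then have "prime_chain (p(Suc (length xs) := Q)) (Suc (length xs)) Q"
    using p snoc.prems(2) unfolding prime_chain_def by (auto simp: less_Suc_eq le_Suc_eq)
  then show ?case by auto
qed

end


section \<open>Depth\<close>

context cring
begin

lemma nonzerodivisor_quotient:
  assumes I: "ideal I R" and x: "x \<in> carrier R"
  shows "nonzerodivisor (R Quot I) (I +> x) \<longleftrightarrow> nzd I x"
proof -
  have car: "carrier (R Quot I) = (\<lambda>y. I +> y) ` carrier R"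
    unfolding FactRing_def A_RCOSETS_def' by auto
  have mem: "I +> y = I \<longleftrightarrow> y \<in> I" if "y \<in> carrier R" for y
    using that a_rcos_zero[OF I] ideal.rcos_const_imp_mem[OF I that] by auto
  have "(I +> x) \<otimes>\<^bsub>R Quot I\<^esub> (I +> y) = I +> (x \<otimes> y)" if "y \<in> carrier R" for y
    using ideal.rcoset_mult_add[OF I x that] unfolding FactRing_def by simp
  moreover have "\<zero>\<^bsub>R Quot I\<^esub> = I" unfolding FactRing_def by simp
  ultimately show ?thesis
    using x mem unfolding nonzerodivisor_def nzd_def car by auto
qed

lemma genideal_eq_adjoin:
  assumes "set xs \<subseteq> carrier R"
  shows "Idl (set xs) = adjoin {\<zero>} xs"
proof
  show "Idl (set xs) \<subseteq> adjoin {\<zero>} xs"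
    using set_adjoin[OF zeroideal assms] adjoin_ideal[OF zeroideal assms] by (intro genideal_minimal)
  show "adjoin {\<zero>} xs \<subseteq> Idl (set xs)"
    using genideal_ideal[OF assms] genideal_self[OF assms] ideal_zero
    by (intro adjoin_minimal[OF zeroideal]) auto
qed

lemma regular_over_iff_nth:
  "regular_over J xs \<longleftrightarrow> (\<forall>i<length xs. nzd (adjoin J (take i xs)) (xs ! i))"
  by (induction xs arbitrary: J) (auto simp: less_Suc_eq_0_disj)

lemma regular_sequence_iff:
  "regular_sequence R xs \<longleftrightarrow> regular_over {\<zero>} xs \<and> adjoin {\<zero>} xs \<noteq> carrier R"
proof (cases "set xs \<subseteq> carrier R")
  case True
  have "nonzerodivisor (R Quot I) (I +> xs ! i) \<longleftrightarrow> nzd (adjoin {\<zero>} (take i xs)) (xs ! i)"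
    if "i < length xs" "I = Idl (set (take i xs))" for i I
  proof -
    have i: "set (take i xs) \<subseteq> carrier R" using True set_take_subset by fast
    have "xs ! i \<in> carrier R" using True that by auto
    then show ?thesis
      using nonzerodivisor_quotient[OF genideal_ideal[OF i]] genideal_eq_adjoin[OF i] that by auto
  qed
  then show ?thesis
    using True genideal_eq_adjoin[OF True] unfolding regular_sequence_def regular_over_iff_nth Let_def
    by auto
next
  case False
  then show ?thesis using regular_over_carrier unfolding regular_sequence_def by auto
qed

text \<open>This means \<open>Hom(R / I, R / L) \<noteq> 0\<close>.\<close>

definition annihilated :: "'a set \<Rightarrow> 'a set \<Rightarrow> bool"
  where "annihilated I L \<longleftrightarrow> (\<exists>u\<in>carrier R - L. \<forall>a\<in>I. a \<otimes> u \<in> L)"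

text \<open>If \<open>x \<otimes> a\<close> is \<open>b \<otimes> z\<close> modulo \<open>J\<close>,
  then regularity of \<open>z\<close> modulo \<open>adj J x\<close> makes \<open>b\<close> a
  multiple of \<open>x\<close> modulo \<open>J\<close>. Cancelling \<open>x\<close> shows that
  \<open>a\<close> is a multiple of \<open>z\<close>.\<close>

lemma nzd_exchange:
  assumes J: "ideal J R" and x: "nzd J x" and z: "nzd J z" "nzd (adj J x) z"
  shows "nzd (adj J z) x"
  unfolding nzd_def
proof (intro conjI ballI impI)
  show xc: "x \<in> carrier R" using x unfolding nzd_def by auto
  have zc: "z \<in> carrier R" using z unfolding nzd_def by auto
  fix a assume a: "a \<in> carrier R" "x \<otimes> a \<in> adj J z"
  from a(2) obtain j b where j: "j \<in> J" "b \<in> carrier R" "x \<otimes> a = j \<oplus> b \<otimes> z" by (rule adjE)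
  have jc: "j \<in> carrier R" using j ideal_carrier[OF J] by auto
  have "z \<otimes> b = (j \<oplus> b \<otimes> z) \<ominus> j" using zc j(2) jc by algebra
  also have "\<dots> = \<ominus> j \<oplus> a \<otimes> x" unfolding j(3)[symmetric] using xc a(1) jc by algebra
  also have "\<dots> \<in> adj J x" using adjI[OF ideal_uminus[OF J j(1)] a(1)] .
  finally have "b \<in> adj J x" using z(2) j(2) unfolding nzd_def by auto
  then obtain k c where k: "k \<in> J" "c \<in> carrier R" "b = k \<oplus> c \<otimes> x" by (rule adjE)
  have kc: "k \<in> carrier R" using k ideal_carrier[OF J] by auto
  have "x \<otimes> (a \<ominus> c \<otimes> z) = x \<otimes> a \<ominus> x \<otimes> (c \<otimes> z)" using a(1) xc zc k(2) by algebra
  also have "\<dots> = j \<oplus> z \<otimes> k" unfolding j(3) k(3) using k(2) kc jc xc zc by algebra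
  also have "\<dots> \<in> J" using ideal_add[OF J j(1) ideal_lmult[OF J zc k(1)]] .
  finally have "a \<ominus> c \<otimes> z \<in> J" using x a(1) k(2) zc unfolding nzd_def by auto
  then have "(a \<ominus> c \<otimes> z) \<oplus> c \<otimes> z \<in> adj J z" using k(2) by (rule adjI)
  moreover have "(a \<ominus> c \<otimes> z) \<oplus> c \<otimes> z = a" using a(1) k(2) zc by algebra
  ultimately show "a \<in> adj J z" by simp
qed

text \<open>A class \<open>u\<close> killed by \<open>I\<close> modulo \<open>x\<close> determines
  \<open>v\<close> by the relation that \<open>y \<otimes> u\<close> is \<open>v \<otimes> x\<close>
  modulo \<open>J\<close>. Cancelling \<open>x\<close> shows that \<open>I\<close> kills
  \<open>v\<close> modulo \<open>y\<close>; cancelling \<open>y\<close> shows that \<open>v\<close>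
  is nonzero there because \<open>u\<close> is nonzero modulo \<open>x\<close>.\<close>

lemma annihilated_exchange:
  assumes J: "ideal J R" and I: "ideal I R" and x: "nzd J x" "x \<in> I" and y: "nzd J y" "y \<in> I"
    and ann: "annihilated I (adj J x)"
  shows "annihilated I (adj J y)"
proof -
  have c: "x \<in> carrier R" "y \<in> carrier R" using x y unfolding nzd_def by auto
  obtain u where u: "u \<in> carrier R" "u \<notin> adj J x" "\<And>a. a \<in> I \<Longrightarrow> a \<otimes> u \<in> adj J x"
    using ann unfolding annihilated_def by auto
  from u(3)[OF y(2)] obtain j v where j: "j \<in> J" "v \<in> carrier R" "y \<otimes> u = j \<oplus> v \<otimes> x" by (rule adjE)
  have jc: "j \<in> carrier R" using j ideal_carrier[OF J] by auto
  have "v \<notin> adj J y"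
  proof
    assume "v \<in> adj J y"
    then obtain k w where k: "k \<in> J" "w \<in> carrier R" "v = k \<oplus> w \<otimes> y" by (rule adjE)
    have kc: "k \<in> carrier R" using k ideal_carrier[OF J] by auto
    have "y \<otimes> (u \<ominus> w \<otimes> x) = y \<otimes> u \<ominus> y \<otimes> (w \<otimes> x)" using u(1) k(2) c by algebra
    also have "\<dots> = j \<oplus> x \<otimes> k" unfolding j(3) k(3) using jc k(2) kc c by algebra
    also have "\<dots> \<in> J" using ideal_add[OF J j(1) ideal_lmult[OF J c(1) k(1)]] .
    finally have "u \<ominus> w \<otimes> x \<in> J" using y(1) u(1) k(2) c unfolding nzd_def by auto
    then have "(u \<ominus> w \<otimes> x) \<oplus> w \<otimes> x \<in> adj J x" using k(2) by (rule adjI)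
    moreover have "(u \<ominus> w \<otimes> x) \<oplus> w \<otimes> x = u" using u(1) k(2) c by algebra
    ultimately show False using u(2) by simp
  qed
  moreover have "a \<otimes> v \<in> adj J y" if a: "a \<in> I" for a
  proof -
    have ac: "a \<in> carrier R" using a ideal_carrier[OF I] by auto
    from u(3)[OF a] obtain k s where k: "k \<in> J" "s \<in> carrier R" "a \<otimes> u = k \<oplus> s \<otimes> x" by (rule adjE)
    have kc: "k \<in> carrier R" using k ideal_carrier[OF J] by auto
    have "x \<otimes> (a \<otimes> v \<ominus> s \<otimes> y) = a \<otimes> (j \<oplus> v \<otimes> x) \<ominus> a \<otimes> j \<ominus> y \<otimes> (s \<otimes> x)"
      using c ac j(2) jc k(2) by algebra
    also have "\<dots> = y \<otimes> (a \<otimes> u) \<ominus> a \<otimes> j \<ominus> y \<otimes> (s \<otimes> x)"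
      unfolding j(3)[symmetric] using c ac jc u(1) k(2) by algebra
    also have "\<dots> = y \<otimes> k \<ominus> a \<otimes> j" unfolding k(3) using c ac jc kc k(2) by algebra
    also have "\<dots> \<in> J" using ideal_minus[OF J ideal_lmult[OF J c(2) k(1)] ideal_lmult[OF J ac j(1)]] .
    finally have "a \<otimes> v \<ominus> s \<otimes> y \<in> J" using x(1) ac j(2) k(2) c unfolding nzd_def by auto
    then have "(a \<otimes> v \<ominus> s \<otimes> y) \<oplus> s \<otimes> y \<in> adj J y" using k(2) by (rule adjI)
    moreover have "(a \<otimes> v \<ominus> s \<otimes> y) \<oplus> s \<otimes> y = a \<otimes> v" using ac j(2) k(2) c by algebra
    ultimately show ?thesis by simp
  qed
  ultimately show ?thesis using j(2) unfolding annihilated_def by auto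
qed

lemma adjoin_adj_commute:
  "ideal J R \<Longrightarrow> set xs \<subseteq> carrier R \<Longrightarrow> z \<in> carrier R \<Longrightarrow> adjoin (adj J z) xs = adj (adjoin J xs) z"
proof (induction xs arbitrary: J)
  case (Cons x xs)
  then show ?case using adj_commute[of J z x] Cons.IH[of "adj J x"] adj_ideal[of J x] by auto
qed simp

text \<open>\<open>z\<close> is moved to the front past one term at a time by
  \<open>nzd_exchange\<close>. Passing the last term uses the case
  \<open>i = length xs\<close>.\<close>

lemma regular_over_adj:
  assumes "ideal J R" "regular_over J xs" "\<And>i. i \<le> length xs \<Longrightarrow> nzd (adjoin J (take i xs)) z"
  shows "regular_over (adj J z) xs"
  using assms
proof (induction xs arbitrary: J)
  case (Cons x xs)
  have z: "nzd J z" "nzd (adj J x) z" using Cons.prems(3)[of 0] Cons.prems(3)[of 1] by auto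
  have x: "nzd J x" using Cons.prems(2) by simp
  have c: "x \<in> carrier R" "z \<in> carrier R" using x z unfolding nzd_def by auto
  have "regular_over (adj (adj J x) z) xs"
  proof (rule Cons.IH)
    show "ideal (adj J x) R" using Cons.prems c adj_ideal by auto
    show "nzd (adjoin (adj J x) (take i xs)) z" if "i \<le> length xs" for i
      using Cons.prems(3)[of "Suc i"] that by auto
  qed (use Cons.prems in auto)
  then show ?case using nzd_exchange[of J x z] Cons.prems z adj_commute[OF Cons.prems(1) c] by auto
qed simp

end

section \<open>Invariance of the length of maximal regular sequences\<close>

context noetherian_cring
begin

text \<open>If \<open>I\<close> consists of zero divisors on \<open>R / L\<close>, the finitely many
  associated primes cover it, and prime avoidance selects one containing \<open>I\<close>. The
  element whose annihilator is that prime is killed by \<open>I\<close>.\<close>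

lemma annihilated_iff:
  assumes I: "ideal I R" and L: "ideal L R"
  shows "annihilated I L \<longleftrightarrow> (\<forall>x\<in>I. \<not> nzd L x)" "annihilated I L \<longleftrightarrow> (\<exists>P\<in>assoc_primes L. I \<subseteq> P)"
proof -
  have 1: "\<forall>x\<in>I. \<not> nzd L x" if "annihilated I L" using that unfolding annihilated_def nzd_def by auto
  have 2: "\<exists>P\<in>assoc_primes L. I \<subseteq> P" if "\<forall>x\<in>I. \<not> nzd L x"
  proof (rule prime_avoidance[OF finite_assoc_primes[OF L] _ I])
    show "I \<subseteq> \<Union>(assoc_primes L)"
      using that zero_divisor_in_assoc_prime[OF L] ideal_carrier[OF I] by blast
  qed (auto simp: assoc_primes_def)
  have 3: "annihilated I L" if ex: "\<exists>P\<in>assoc_primes L. I \<subseteq> P"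
  proof -
    obtain a where a: "a \<in> carrier R" "primeideal (colon L a) R" "I \<subseteq> colon L a"
      using ex unfolding assoc_primes_def by auto
    have "a \<notin> L" using prime_one[OF a(2)] a(1) unfolding colon_def by auto
    then show ?thesis using a unfolding annihilated_def colon_def by auto
  qed
  show "annihilated I L \<longleftrightarrow> (\<forall>x\<in>I. \<not> nzd L x)" "annihilated I L \<longleftrightarrow> (\<exists>P\<in>assoc_primes L. I \<subseteq> P)"
    using 1 2 3 by blast+
qed

text \<open>An elementary form of the isomorphism of \<open>Ext\<^sup>n(R / I, R / J)\<close> with
  \<open>Hom(R / I, R / (J, x\<^sub>1, \<dots>, x\<^sub>n))\<close>. A common nonzerodivisor \<open>z\<close> replaces both last elements and
  is then moved to the front.\<close>

lemma annihilated_regular_over: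
  assumes I: "ideal I R" and "ideal J R" "regular_over J xs" "regular_over J ys" "length xs = length ys"
    and "set xs \<subseteq> I" "set ys \<subseteq> I" "annihilated I (adjoin J xs)"
  shows "annihilated I (adjoin J ys)"
  using assms(2-)
proof (induction "length xs" arbitrary: J xs ys)
  case 0
  then show ?case by simp
next
  case (Suc n)
  note J = Suc.prems(1)
  obtain xs' x where xs: "xs = xs' @ [x]" "length xs' = n"
    using Suc.hyps(2) by (metis length_Suc_conv_rev)
  obtain ys' y where ys: "ys = ys' @ [y]" "length ys' = n"
    using Suc.hyps(2) Suc.prems(4) by (metis length_Suc_conv_rev)
  \<comment> \<open>The index stops at \<open>n\<close>, one less than the length: \<open>z\<close>
    is to replace both last terms, so it has to be regular modulo all of \<open>xs'\<close> and all
    of \<open>ys'\<close>. Each of these ideals has the next term of its own sequence as a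
    nonzerodivisor in \<open>I\<close>.\<close>
  let ?F = "(\<lambda>i. adjoin J (take i xs)) ` {..n} \<union> (\<lambda>i. adjoin J (take i ys)) ` {..n}"
  have c: "set xs \<subseteq> carrier R" "set ys \<subseteq> carrier R" using Suc.prems ideal_carrier[OF I] by auto
  have id: "ideal L R" if "L \<in> ?F" for L
    using that adjoin_ideal[OF J] c set_take_subset by (metis (no_types, lifting) UnE imageE subset_trans)
  have "\<exists>z\<in>I. \<forall>L\<in>?F. nzd L z"
  proof (rule exists_common_nzd[OF I _ id])
    fix L assume "L \<in> ?F"
    then obtain zs i where zs: "regular_over J zs" "set zs \<subseteq> I" "i < length zs" "L = adjoin J (take i zs)"
    proof (cases "\<exists>i\<le>n. L = adjoin J (take i xs)")
      case True
      then obtain i where "i \<le> n" "L = adjoin J (take i xs)" by blast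
      then show ?thesis using that[of xs i] Suc.prems(2,5) xs by simp
    next
      case False
      then obtain i where "i \<le> n" "L = adjoin J (take i ys)" using \<open>L \<in> ?F\<close> by blast
      then show ?thesis using that[of ys i] Suc.prems(3,6) ys by simp
    qed
    then have "nzd L (zs ! i)" "zs ! i \<in> I" using zs unfolding regular_over_iff_nth by auto
    then show "\<exists>x\<in>I. nzd L x" by blast
  qed auto
  then obtain z where z: "z \<in> I" "\<And>L. L \<in> ?F \<Longrightarrow> nzd L z" by blast
  have zx: "nzd (adjoin J (take i xs')) z" if "i \<le> n" for i using that z(2) xs by auto
  have zy: "nzd (adjoin J (take i ys')) z" if "i \<le> n" for i using that z(2) ys by auto
  have zc: "z \<in> carrier R" using z ideal_carrier[OF I] by auto
  have c': "set xs' \<subseteq> carrier R" "set ys' \<subseteq> carrier R" using c xs ys by auto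
  have rx: "regular_over J xs'" "nzd (adjoin J xs') x" and ry: "regular_over J ys'" "nzd (adjoin J ys') y"
    using Suc.prems xs ys by (auto simp: regular_over_append)
  have "annihilated I (adj (adjoin J xs') x)" using Suc.prems xs by simp
  then have "annihilated I (adj (adjoin J xs') z)"
    using annihilated_exchange[OF adjoin_ideal[OF J c'(1)] I rx(2)] zx[of n] z Suc.prems xs by auto
  then have "annihilated I (adjoin (adj J z) xs')" using adjoin_adj_commute[OF J c'(1) zc] by simp
  then have "annihilated I (adjoin (adj J z) ys')"
    using Suc.hyps(1)[of xs' "adj J z" ys'] xs ys Suc.prems adj_ideal[OF J zc]
      regular_over_adj[OF J rx(1)] regular_over_adj[OF J ry(1)] zx zy by auto
  then have "annihilated I (adj (adjoin J ys') z)" using adjoin_adj_commute[OF J c'(2) zc] by simp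
  then have "annihilated I (adj (adjoin J ys') y)"
    using annihilated_exchange[OF adjoin_ideal[OF J c'(2)] I _ _ ry(2)] zy[of n] z Suc.prems ys by auto
  then show ?case using ys by simp
qed

section \<open>Depth with respect to a proper ideal\<close>

context
  fixes I
  assumes I: "ideal I R" "I \<noteq> carrier R"
begin

lemma regular_sequence_in_iff:
  assumes "set xs \<subseteq> I"
  shows "regular_sequence R xs \<longleftrightarrow> regular_over {\<zero>} xs"
proof -
  have "adjoin {\<zero>} xs \<subseteq> I" using adjoin_minimal[OF zeroideal I(1)] assms ideal_zero[OF I(1)] by auto
  then show ?thesis using I ideal_subset[OF I(1)] unfolding regular_sequence_iff by auto
qed

lemma adjoin_zero_ideal: "set xs \<subseteq> I \<Longrightarrow> ideal (adjoin {\<zero>} xs) R"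
  using adjoin_ideal[OF zeroideal] ideal_subset[OF I(1)] by auto

lemma maximal_regular_sequence_iff:
  "maximal_regular_sequence_in R I xs \<longleftrightarrow>
    set xs \<subseteq> I \<and> regular_over {\<zero>} xs \<and> annihilated I (adjoin {\<zero>} xs)"
proof (cases "set xs \<subseteq> I \<and> regular_over {\<zero>} xs")
  case True
  then have "regular_sequence R (xs @ [x]) \<longleftrightarrow> nzd (adjoin {\<zero>} xs) x" if "x \<in> I" for x
    using that regular_sequence_in_iff[of "xs @ [x]"] by (auto simp: regular_over_append)
  then show ?thesis
    using True annihilated_iff(1)[OF I(1) adjoin_zero_ideal] regular_sequence_in_iff
    unfolding maximal_regular_sequence_in_def by auto
next
  case False
  then show ?thesis using regular_sequence_in_iff unfolding maximal_regular_sequence_in_def by auto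
qed

text \<open>A longer \<open>ys\<close> would have an initial segment of the length of
  \<open>xs\<close>. By invariance \<open>I\<close> consists of zero divisors modulo that segment,
  but the next term of \<open>ys\<close> is a nonzerodivisor in \<open>I\<close>.\<close>

lemma length_le_maximal_regular_sequence:
  assumes "maximal_regular_sequence_in R I xs" "regular_over {\<zero>} ys" "set ys \<subseteq> I"
  shows "length ys \<le> length xs"
proof (rule ccontr)
  let ?n = "length xs"
  assume n: "\<not> length ys \<le> ?n"
  have xs: "set xs \<subseteq> I" "regular_over {\<zero>} xs" "annihilated I (adjoin {\<zero>} xs)"
    using assms(1) unfolding maximal_regular_sequence_iff by auto
  have ys: "set (take ?n ys) \<subseteq> I" using assms(3) set_take_subset by fast
  have "regular_over {\<zero>} (take ?n ys)"
    using assms(2) append_take_drop_id[of ?n ys] regular_over_append by metis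
  then have "annihilated I (adjoin {\<zero>} (take ?n ys))"
    using annihilated_regular_over[OF I(1) zeroideal xs(2) _ _ xs(1) ys xs(3)] n by auto
  moreover have "nzd (adjoin {\<zero>} (take ?n ys)) (ys ! ?n)" "ys ! ?n \<in> I"
    using assms n unfolding regular_over_iff_nth by auto
  ultimately show False using annihilated_iff(1)[OF I(1) adjoin_zero_ideal[OF ys]] by auto
qed

text \<open>Appending a nonzerodivisor strictly enlarges the generated ideal, because a
  nonzerodivisor modulo a proper ideal is not in that ideal. So noetherian induction on this ideal
  applies.\<close>

lemma exists_maximal_regular_sequence:
  assumes "regular_over {\<zero>} xs" "set xs \<subseteq> I"
  shows "\<exists>zs. maximal_regular_sequence_in R I (xs @ zs)"
proof -
  have "\<exists>zs. maximal_regular_sequence_in R I (xs @ zs)"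
    if "ideal L R" "L = adjoin {\<zero>} xs" "regular_over {\<zero>} xs" "set xs \<subseteq> I" for L xs
    using that
  proof (induction arbitrary: xs rule: noetherian_induct)
    case (step L)
    show ?case
    proof (cases "annihilated I L")
      case True
      then have "maximal_regular_sequence_in R I (xs @ [])"
        using step.prems unfolding maximal_regular_sequence_iff by simp
      then show ?thesis ..
    next
      case False
      then obtain x where x: "x \<in> I" "nzd L x" using annihilated_iff(1)[OF I(1) step.hyps] by auto
      then have xc: "x \<in> carrier R" unfolding nzd_def by auto
      have "\<one> \<notin> L"
        using adjoin_minimal[OF zeroideal I(1)] step.prems ideal_zero[OF I(1)] I ideal_eq_carrier by auto
      then have "x \<notin> L" using x(2) xc unfolding nzd_def by (metis one_closed r_one)
      then have "L \<subset> adj L x" using subset_adj[OF step.hyps xc] self_in_adj[OF step.hyps xc] by auto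
      then obtain zs where "maximal_regular_sequence_in R I ((xs @ [x]) @ zs)"
        using step.IH[OF adj_ideal[OF step.hyps xc], of "xs @ [x]"] step.prems x
        by (auto simp: regular_over_append)
      then show ?thesis by auto
    qed
  qed
  then show ?thesis using adjoin_zero_ideal assms by blast
qed

lemma depth_eq:
  assumes "maximal_regular_sequence_in R I xs"
  shows "depth R I = length xs"
  unfolding depth_def
proof (rule the_equality)
  have "length ys = length xs" if "maximal_regular_sequence_in R I ys" for ys
    using length_le_maximal_regular_sequence assms that maximal_regular_sequence_iff
    by (simp add: order_antisym)
  then show "(\<exists>xs. maximal_regular_sequence_in R I xs) \<and>
    (\<forall>ys. maximal_regular_sequence_in R I ys \<longrightarrow> length ys = length xs)"
    using assms by blast
qed (use assms in blast)

lemma length_le_depth: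
  assumes "regular_over {\<zero>} xs" "set xs \<subseteq> I"
  shows "length xs \<le> depth R I"
  using exists_maximal_regular_sequence[OF assms] depth_eq by fastforce

lemma depth_witness:
  obtains xs where "maximal_regular_sequence_in R I xs" "length xs = depth R I"
  using exists_maximal_regular_sequence[of "[]"] depth_eq by auto

lemma annihilated_of_length_depth:
  assumes "regular_over {\<zero>} xs" "set xs \<subseteq> I" "length xs = depth R I"
  shows "annihilated I (adjoin {\<zero>} xs)"
proof -
  obtain zs where zs: "maximal_regular_sequence_in R I (xs @ zs)"
    using exists_maximal_regular_sequence assms by blast
  then have "zs = []" using depth_eq[OF zs] assms by simp
  then show ?thesis using zs unfolding maximal_regular_sequence_iff by simp
qed

end

end


section \<open>Localization\<close>

locale multiplicative_subset = cring R for R (structure) +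
  fixes S
  assumes S_subset: "S \<subseteq> carrier R" and one_in_S: "\<one> \<in> S"
    and mult_in_S: "\<And>s t. s \<in> S \<Longrightarrow> t \<in> S \<Longrightarrow> s \<otimes> t \<in> S"
begin

abbreviation "fr \<equiv> fraction R S"
abbreviation "F \<equiv> fraction_ring R S"

lemma S_carrier [simp]: "s \<in> S \<Longrightarrow> s \<in> carrier R"
  using S_subset by auto

declare one_in_S [simp] mult_in_S [simp]

lemma equiv_frac_rel: "equiv (carrier R \<times> S) (frac_rel R S)"
proof (rule equivI)
  show "frac_rel R S \<subseteq> (carrier R \<times> S) \<times> (carrier R \<times> S)" unfolding frac_rel_def by auto
  show "refl_on (carrier R \<times> S) (frac_rel R S)"
    using one_in_S unfolding frac_rel_def refl_on_def by auto
  show "sym (frac_rel R S)" unfolding frac_rel_def sym_def by (auto; metis)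
  show "trans (frac_rel R S)"
  proof (rule transI)
    fix x y z assume "(x, y) \<in> frac_rel R S" "(y, z) \<in> frac_rel R S"
    then obtain a s b t c r u v where eqs: "x = (a, s)" "y = (b, t)" "z = (c, r)"
      and c: "a \<in> carrier R" "b \<in> carrier R" "c \<in> carrier R" "s \<in> S" "t \<in> S" "r \<in> S" "u \<in> S" "v \<in> S"
      and u: "u \<otimes> (a \<otimes> t) = u \<otimes> (b \<otimes> s)" and v: "v \<otimes> (b \<otimes> r) = v \<otimes> (c \<otimes> t)"
      unfolding frac_rel_def by auto
    note c' = c(1-3) c(4-8)[THEN S_carrier]
    \<comment> \<open>The denominator \<open>t\<close> of the middle fraction has to be a factor of
      the witness, as it cannot be cancelled.\<close>
    have "((u \<otimes> v) \<otimes> t) \<otimes> (a \<otimes> r) = (v \<otimes> r) \<otimes> (u \<otimes> (a \<otimes> t))" using c' by algebra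
    also have "\<dots> = (u \<otimes> s) \<otimes> (v \<otimes> (b \<otimes> r))" unfolding u using c' by algebra
    also have "\<dots> = ((u \<otimes> v) \<otimes> t) \<otimes> (c \<otimes> s)" unfolding v using c' by algebra
    finally show "(x, z) \<in> frac_rel R S"
      unfolding frac_rel_def eqs using c by (auto intro!: bexI[of _ "(u \<otimes> v) \<otimes> t"])
  qed
qed

lemma fraction_eq_iff:
  assumes "a \<in> carrier R" "b \<in> carrier R" "s \<in> S" "t \<in> S"
  shows "fr a s = fr b t \<longleftrightarrow> (\<exists>u\<in>S. u \<otimes> (a \<otimes> t) = u \<otimes> (b \<otimes> s))"
  using assms eq_equiv_class_iff[OF equiv_frac_rel, of "(a, s)" "(b, t)"]
  unfolding fraction_def by (auto simp: frac_rel_def)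

lemma fraction_eqI:
  assumes "a \<in> carrier R" "b \<in> carrier R" "s \<in> S" "t \<in> S" "a \<otimes> t = b \<otimes> s"
  shows "fr a s = fr b t"
  using assms one_in_S by (subst fraction_eq_iff) auto

lemma mem_fraction:
  assumes "a \<in> carrier R" "s \<in> S" "(b, t) \<in> fr a s"
  shows "b \<in> carrier R" "t \<in> S" "fr b t = fr a s"
proof -
  have rel: "((a, s), (b, t)) \<in> frac_rel R S" using assms(3) unfolding fraction_def by auto
  then show "b \<in> carrier R" "t \<in> S" unfolding frac_rel_def by auto
  show "fr b t = fr a s" using equiv_class_eq[OF equiv_frac_rel rel] unfolding fraction_def by simp
qed

lemma self_mem_fraction: "a \<in> carrier R \<Longrightarrow> s \<in> S \<Longrightarrow> (a, s) \<in> fr a s"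
  unfolding fraction_def using equiv_class_self[OF equiv_frac_rel] by auto

lemma carrier_F: "carrier F = {fr a s | a s. a \<in> carrier R \<and> s \<in> S}"
  unfolding fraction_ring_def quotient_def fraction_def by auto

lemma fraction_closed [simp]: "a \<in> carrier R \<Longrightarrow> s \<in> S \<Longrightarrow> fr a s \<in> carrier F"
  unfolding carrier_F by auto

lemma carrier_FE:
  assumes "x \<in> carrier F"
  obtains a s where "a \<in> carrier R" "s \<in> S" "x = fr a s"
  using assms unfolding carrier_F by auto

text \<open>Independence of representatives makes all members of the double union equal, and the
  classes are nonempty. This evaluates the sum and the product of
  \<open>fraction_ring\<close>.\<close>

lemma UN_fraction_classes:
  assumes c: "a \<in> carrier R" "b \<in> carrier R" "s \<in> S" "t \<in> S"
    and H: "\<And>a' s' b' t'. \<lbrakk>a' \<in> carrier R; s' \<in> S; b' \<in> carrier R; t' \<in> S; fr a' s' = fr a s; fr b' t' = fr b t\<rbrakk>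
      \<Longrightarrow> H a' s' b' t' = H a s b t"
  shows "(\<Union>(a', s')\<in>fr a s. \<Union>(b', t')\<in>fr b t. H a' s' b' t') = H a s b t"
proof -
  have "H a' s' b' t' = H a s b t" if "(a', s') \<in> fr a s" "(b', t') \<in> fr b t" for a' s' b' t'
    using H mem_fraction[OF c(1,3) that(1)] mem_fraction[OF c(2,4) that(2)] by blast
  then show ?thesis using self_mem_fraction[OF c(1,3)] self_mem_fraction[OF c(2,4)] by fast
qed

lemma fraction_mult [simp]:
  assumes c: "a \<in> carrier R" "b \<in> carrier R" "s \<in> S" "t \<in> S"
  shows "fr a s \<otimes>\<^bsub>F\<^esub> fr b t = fr (a \<otimes> b) (s \<otimes> t)"
proof -
  have "fr (a' \<otimes> b') (s' \<otimes> t') = fr (a \<otimes> b) (s \<otimes> t)"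
    if c': "a' \<in> carrier R" "s' \<in> S" "b' \<in> carrier R" "t' \<in> S" and eq: "fr a' s' = fr a s" "fr b' t' = fr b t"
    for a' s' b' t'
  proof -
    obtain u v where u: "u \<in> S" "u \<otimes> (a' \<otimes> s) = u \<otimes> (a \<otimes> s')" and v: "v \<in> S" "v \<otimes> (b' \<otimes> t) = v \<otimes> (b \<otimes> t')"
      using eq c c' fraction_eq_iff by auto
    note C = c(1,2) c(3,4)[THEN S_carrier] c'(1,3) c'(2,4)[THEN S_carrier] u(1)[THEN S_carrier] v(1)[THEN S_carrier]
    have "(u \<otimes> v) \<otimes> ((a' \<otimes> b') \<otimes> (s \<otimes> t)) = (u \<otimes> (a' \<otimes> s)) \<otimes> (v \<otimes> (b' \<otimes> t))" using C by algebra
    also have "\<dots> = (u \<otimes> v) \<otimes> ((a \<otimes> b) \<otimes> (s' \<otimes> t'))" unfolding u(2) v(2) using C by algebra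
    finally show ?thesis using c c' u v by (subst fraction_eq_iff) auto
  qed
  then show ?thesis
    using UN_fraction_classes[OF c, of "\<lambda>a s b t. fr (a \<otimes> b) (s \<otimes> t)"] unfolding fraction_ring_def by simp
qed

lemma fraction_add [simp]:
  assumes c: "a \<in> carrier R" "b \<in> carrier R" "s \<in> S" "t \<in> S"
  shows "fr a s \<oplus>\<^bsub>F\<^esub> fr b t = fr (a \<otimes> t \<oplus> b \<otimes> s) (s \<otimes> t)"
proof -
  have "fr (a' \<otimes> t' \<oplus> b' \<otimes> s') (s' \<otimes> t') = fr (a \<otimes> t \<oplus> b \<otimes> s) (s \<otimes> t)"
    if c': "a' \<in> carrier R" "s' \<in> S" "b' \<in> carrier R" "t' \<in> S" and eq: "fr a' s' = fr a s" "fr b' t' = fr b t"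
    for a' s' b' t'
  proof -
    obtain u v where u: "u \<in> S" "u \<otimes> (a' \<otimes> s) = u \<otimes> (a \<otimes> s')" and v: "v \<in> S" "v \<otimes> (b' \<otimes> t) = v \<otimes> (b \<otimes> t')"
      using eq c c' fraction_eq_iff by auto
    note C = c(1,2) c(3,4)[THEN S_carrier] c'(1,3) c'(2,4)[THEN S_carrier] u(1)[THEN S_carrier] v(1)[THEN S_carrier]
    have "(u \<otimes> v) \<otimes> ((a' \<otimes> t' \<oplus> b' \<otimes> s') \<otimes> (s \<otimes> t))
        = (v \<otimes> (t' \<otimes> t)) \<otimes> (u \<otimes> (a' \<otimes> s)) \<oplus> (u \<otimes> (s' \<otimes> s)) \<otimes> (v \<otimes> (b' \<otimes> t))" using C by algebra
    also have "\<dots> = (u \<otimes> v) \<otimes> ((a \<otimes> t \<oplus> b \<otimes> s) \<otimes> (s' \<otimes> t'))" unfolding u(2) v(2) using C by algebra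
    finally show ?thesis using c c' u v by (subst fraction_eq_iff) auto
  qed
  then show ?thesis
    using UN_fraction_classes[OF c, of "\<lambda>a s b t. fr (a \<otimes> t \<oplus> b \<otimes> s) (s \<otimes> t)"]
    unfolding fraction_ring_def by simp
qed

lemma one_F: "\<one>\<^bsub>F\<^esub> = fr \<one> \<one>" and zero_F: "\<zero>\<^bsub>F\<^esub> = fr \<zero> \<one>"
  unfolding fraction_ring_def by simp_all

lemma cring_fraction_ring: "cring F"
proof (rule cringI)
  show "abelian_group F"
  proof (rule abelian_groupI)
    fix x y assume "x \<in> carrier F" "y \<in> carrier F"
    then obtain a s b t where 1: "a \<in> carrier R" "s \<in> S" "x = fr a s" "b \<in> carrier R" "t \<in> S" "y = fr b t"
      by (metis carrier_FE)
    then show "x \<oplus>\<^bsub>F\<^esub> y \<in> carrier F" by simp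
    show "x \<oplus>\<^bsub>F\<^esub> y = y \<oplus>\<^bsub>F\<^esub> x" using 1 by (simp add: a_comm m_comm)
    fix z assume "z \<in> carrier F"
    then obtain c r where 2: "c \<in> carrier R" "r \<in> S" "z = fr c r" by (rule carrier_FE)
    have "((a \<otimes> t \<oplus> b \<otimes> s) \<otimes> r \<oplus> c \<otimes> (s \<otimes> t)) \<otimes> (s \<otimes> (t \<otimes> r)) =
      (a \<otimes> (t \<otimes> r) \<oplus> (b \<otimes> r \<oplus> c \<otimes> t) \<otimes> s) \<otimes> (s \<otimes> t \<otimes> r)"
      using 1(1,4) 2(1) 1(2,5)[THEN S_carrier] 2(2)[THEN S_carrier] by algebra
    then have "fr ((a \<otimes> t \<oplus> b \<otimes> s) \<otimes> r \<oplus> c \<otimes> (s \<otimes> t)) (s \<otimes> t \<otimes> r) =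
      fr (a \<otimes> (t \<otimes> r) \<oplus> (b \<otimes> r \<oplus> c \<otimes> t) \<otimes> s) (s \<otimes> (t \<otimes> r))"
      by (rule fraction_eqI[rotated 4]) (use 1(1,2,4,5) 2(1,2) in auto)
    then show "x \<oplus>\<^bsub>F\<^esub> y \<oplus>\<^bsub>F\<^esub> z = x \<oplus>\<^bsub>F\<^esub> (y \<oplus>\<^bsub>F\<^esub> z)"
      unfolding 1(3,6) 2(3) using 1(1,2,4,5) 2(1,2) by simp
  next
    show "\<zero>\<^bsub>F\<^esub> \<in> carrier F" by (simp add: zero_F)
  next
    fix x assume "x \<in> carrier F"
    then obtain a s where 1: "a \<in> carrier R" "s \<in> S" "x = fr a s" by (rule carrier_FE)
    then show "\<zero>\<^bsub>F\<^esub> \<oplus>\<^bsub>F\<^esub> x = x" by (simp add: zero_F)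
    have "(\<ominus> a \<otimes> s \<oplus> a \<otimes> s) \<otimes> \<one> = \<zero> \<otimes> (s \<otimes> s)"
      using 1(1) 1(2)[THEN S_carrier] by algebra
    then have "fr (\<ominus> a \<otimes> s \<oplus> a \<otimes> s) (s \<otimes> s) = fr \<zero> \<one>"
      by (rule fraction_eqI[rotated 4]) (use 1(1,2) in auto)
    then have "fr (\<ominus> a) s \<oplus>\<^bsub>F\<^esub> x = \<zero>\<^bsub>F\<^esub>"
      unfolding 1(3) zero_F using 1(1,2) by simp
    then show "\<exists>y\<in>carrier F. y \<oplus>\<^bsub>F\<^esub> x = \<zero>\<^bsub>F\<^esub>" using 1 by (intro bexI[of _ "fr (\<ominus> a) s"]) auto
  qed
  show "comm_monoid F"
  proof (rule comm_monoidI)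
    fix x y assume "x \<in> carrier F" "y \<in> carrier F"
    then obtain a s b t where 1: "a \<in> carrier R" "s \<in> S" "x = fr a s" "b \<in> carrier R" "t \<in> S" "y = fr b t"
      by (metis carrier_FE)
    then show "x \<otimes>\<^bsub>F\<^esub> y \<in> carrier F" by simp
    show "x \<otimes>\<^bsub>F\<^esub> y = y \<otimes>\<^bsub>F\<^esub> x" using 1 by (simp add: m_comm)
    fix z assume "z \<in> carrier F"
    then obtain c r where 2: "c \<in> carrier R" "r \<in> S" "z = fr c r" by (rule carrier_FE)
    then show "x \<otimes>\<^bsub>F\<^esub> y \<otimes>\<^bsub>F\<^esub> z = x \<otimes>\<^bsub>F\<^esub> (y \<otimes>\<^bsub>F\<^esub> z)" using 1 by (simp add: m_assoc)
  next
    show "\<one>\<^bsub>F\<^esub> \<in> carrier F" by (simp add: one_F)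
    fix x assume "x \<in> carrier F"
    then show "\<one>\<^bsub>F\<^esub> \<otimes>\<^bsub>F\<^esub> x = x" by (auto elim!: carrier_FE simp: one_F)
  qed
  fix x y z assume "x \<in> carrier F" "y \<in> carrier F" "z \<in> carrier F"
  then obtain a s b t c r where 1: "a \<in> carrier R" "s \<in> S" "x = fr a s" "b \<in> carrier R" "t \<in> S" "y = fr b t"
    "c \<in> carrier R" "r \<in> S" "z = fr c r"
    by (metis carrier_FE)
  have "((a \<otimes> t \<oplus> b \<otimes> s) \<otimes> c) \<otimes> (s \<otimes> r \<otimes> (t \<otimes> r)) =
      (a \<otimes> c \<otimes> (t \<otimes> r) \<oplus> b \<otimes> c \<otimes> (s \<otimes> r)) \<otimes> (s \<otimes> t \<otimes> r)"
    using 1(1,4,7) 1(2,5,8)[THEN S_carrier] by algebra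
  then have "fr ((a \<otimes> t \<oplus> b \<otimes> s) \<otimes> c) (s \<otimes> t \<otimes> r) =
      fr (a \<otimes> c \<otimes> (t \<otimes> r) \<oplus> b \<otimes> c \<otimes> (s \<otimes> r)) (s \<otimes> r \<otimes> (t \<otimes> r))"
    by (rule fraction_eqI[rotated 4]) (use 1(1,2,4,5,7,8) in auto)
  then show "(x \<oplus>\<^bsub>F\<^esub> y) \<otimes>\<^bsub>F\<^esub> z = x \<otimes>\<^bsub>F\<^esub> z \<oplus>\<^bsub>F\<^esub> y \<otimes>\<^bsub>F\<^esub> z"
    unfolding 1(3,6,9) using 1(1,2,4,5,7,8) by simp
qed

sublocale F: cring F
  by (rule cring_fraction_ring)

text \<open>Changing the denominator is multiplication by \<open>fr s t\<close>, so ideals see only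
  numerators.\<close>

lemma fraction_mem_ideal_iff:
  assumes K: "ideal K F" and c: "a \<in> carrier R" "s \<in> S" "t \<in> S"
  shows "fr a s \<in> K \<longleftrightarrow> fr a t \<in> K"
proof -
  have "fr a t \<in> K" if "fr a s \<in> K" "s \<in> S" "t \<in> S" for s t
  proof -
    have "fr (s \<otimes> a) (t \<otimes> s) = fr a t" using that(2,3) c(1) by (intro fraction_eqI) (simp_all add: m_ac)
    then have "fr s t \<otimes>\<^bsub>F\<^esub> fr a s = fr a t" using that(2,3) c(1) by simp
    moreover have "fr s t \<otimes>\<^bsub>F\<^esub> fr a s \<in> K" using that by (intro F.ideal_lmult[OF K]) auto
    ultimately show ?thesis by simp
  qed
  then show ?thesis using c by blast
qed

section \<open>Extension and contraction of ideals\<close>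

definition contraction :: "('a \<times> 'a) set set \<Rightarrow> 'a set"
  where "contraction K = {a \<in> carrier R. fr a \<one> \<in> K}"

definition extension :: "'a set \<Rightarrow> ('a \<times> 'a) set set"
  where "extension L = {fr a s | a s. a \<in> L \<and> s \<in> S}"

lemma fraction_mem_extension: "a \<in> L \<Longrightarrow> s \<in> S \<Longrightarrow> fr a s \<in> extension L"
  unfolding extension_def by auto

lemma fraction_mem_iff_contraction:
  "ideal K F \<Longrightarrow> a \<in> carrier R \<Longrightarrow> s \<in> S \<Longrightarrow> fr a s \<in> K \<longleftrightarrow> a \<in> contraction K"
  using fraction_mem_ideal_iff[of K a s \<one>] unfolding contraction_def by auto

lemma contraction_ideal:
  assumes K: "ideal K F"
  shows "ideal (contraction K) R"
proof (rule idealI_cring)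
  show "\<zero> \<in> contraction K" using F.ideal_zero[OF K] unfolding contraction_def zero_F by auto
  fix a b assume "a \<in> contraction K"
  then have a: "a \<in> carrier R" "fr a \<one> \<in> K" unfolding contraction_def by auto
  { assume "b \<in> contraction K"
    then have b: "b \<in> carrier R" "fr b \<one> \<in> K" unfolding contraction_def by auto
    then show "a \<oplus> b \<in> contraction K"
      using F.ideal_add[OF K a(2) b(2)] a unfolding contraction_def by auto }
  assume "b \<in> carrier R"
  then show "b \<otimes> a \<in> contraction K"
    using F.ideal_lmult[OF K _ a(2), of "fr b \<one>"] a unfolding contraction_def by auto
qed (auto simp: contraction_def)

text \<open>An ideal is determined by the numerators of its fractions, so the images of finitely
  many generators of its contraction generate it.\<close>

lemma noetherian_fraction_ring:
  assumes "noetherian_ring R"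
  shows "noetherian_ring F"
proof (rule F.noetherian_ringI)
  fix K assume K: "ideal K F"
  obtain A where A: "A \<subseteq> carrier R" "finite A" "contraction K = Idl A"
    using noetherian_ring.finetely_gen[OF assms contraction_ideal[OF K]] by auto
  let ?B = "(\<lambda>a. fr a \<one>) ` A"
  have B: "?B \<subseteq> carrier F" using A by auto
  note idB = F.genideal_ideal[OF B]
  have "K \<subseteq> Idl\<^bsub>F\<^esub> ?B"
  proof
    fix x assume x: "x \<in> K"
    then obtain a s where a: "a \<in> carrier R" "s \<in> S" "x = fr a s"
      using F.ideal_carrier[OF K] carrier_FE by metis
    then have "a \<in> Idl A" using x fraction_mem_iff_contraction[OF K] A by auto
    moreover have "A \<subseteq> contraction (Idl\<^bsub>F\<^esub> ?B)"
      using F.genideal_self[OF B] A unfolding contraction_def by auto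
    ultimately have "a \<in> contraction (Idl\<^bsub>F\<^esub> ?B)"
      using genideal_minimal[OF contraction_ideal[OF idB]] by auto
    then show "x \<in> Idl\<^bsub>F\<^esub> ?B" using fraction_mem_iff_contraction[OF idB] a by auto
  qed
  moreover have "Idl\<^bsub>F\<^esub> ?B \<subseteq> K"
    using genideal_self[OF A(1)] A(3) by (intro F.genideal_minimal[OF K]) (auto simp: contraction_def)
  ultimately show "\<exists>B\<subseteq>carrier F. finite B \<and> K = Idl\<^bsub>F\<^esub> B" using B A by blast
qed

text \<open>The factor \<open>u\<close> accounts for the other representatives: \<open>a\<close>
  itself need not lie in \<open>L\<close> unless \<open>L\<close> is saturated.\<close>

lemma fraction_mem_extension_iff:
  assumes L: "ideal L R" and c: "a \<in> carrier R" "s \<in> S"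
  shows "fr a s \<in> extension L \<longleftrightarrow> (\<exists>u\<in>S. u \<otimes> a \<in> L)"
proof
  assume "fr a s \<in> extension L"
  then obtain b t where b: "b \<in> L" "t \<in> S" "fr a s = fr b t" unfolding extension_def by auto
  have bc: "b \<in> carrier R" using b ideal_carrier[OF L] by auto
  then obtain u where u: "u \<in> S" "u \<otimes> (a \<otimes> t) = u \<otimes> (b \<otimes> s)" using b c fraction_eq_iff by auto
  have "(u \<otimes> t) \<otimes> a = (u \<otimes> s) \<otimes> b" using u b(2) bc c by (simp add: m_ac)
  moreover have "(u \<otimes> s) \<otimes> b \<in> L" using u c b(1) by (intro ideal_lmult[OF L]) auto
  ultimately have "(u \<otimes> t) \<otimes> a \<in> L" by simp
  then show "\<exists>u\<in>S. u \<otimes> a \<in> L" using u(1) b(2) mult_in_S by blast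
next
  assume "\<exists>u\<in>S. u \<otimes> a \<in> L"
  then obtain u where u: "u \<in> S" "u \<otimes> a \<in> L" by auto
  have "fr a s = fr (u \<otimes> a) (u \<otimes> s)" using u(1) c by (intro fraction_eqI) (auto simp: m_ac)
  then show "fr a s \<in> extension L" using u c by (simp add: fraction_mem_extension)
qed

lemma extension_ideal:
  assumes L: "ideal L R"
  shows "ideal (extension L) F"
proof (rule F.idealI_cring)
  note Lc = ideal_carrier[OF L]
  show "extension L \<subseteq> carrier F" using Lc unfolding extension_def by auto
  show "\<zero>\<^bsub>F\<^esub> \<in> extension L" using ideal_zero[OF L] unfolding zero_F by (simp add: fraction_mem_extension)
  fix x y assume "x \<in> extension L"
  then obtain a s where a: "a \<in> L" "s \<in> S" "x = fr a s" unfolding extension_def by auto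
  { assume "y \<in> extension L"
    then obtain b t where b: "b \<in> L" "t \<in> S" "y = fr b t" unfolding extension_def by auto
    have "a \<otimes> t \<oplus> b \<otimes> s \<in> L" using a b by (intro ideal_add[OF L] ideal_rmult[OF L]) auto
    then show "x \<oplus>\<^bsub>F\<^esub> y \<in> extension L" using a b Lc by (simp add: fraction_mem_extension) }
  assume "y \<in> carrier F"
  then obtain b t where b: "b \<in> carrier R" "t \<in> S" "y = fr b t" by (rule carrier_FE)
  then show "y \<otimes>\<^bsub>F\<^esub> x \<in> extension L"
    using a Lc ideal_lmult[OF L b(1) a(1)] by (simp add: fraction_mem_extension)
qed

lemma extension_zero: "extension {\<zero>} = {\<zero>\<^bsub>F\<^esub>}"
proof -
  have "fr \<zero> s = \<zero>\<^bsub>F\<^esub>" if "s \<in> S" for s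
    using that unfolding zero_F by (intro fraction_eqI) auto
  then show ?thesis using one_in_S unfolding extension_def by blast
qed

lemma extension_adj:
  assumes L: "ideal L R" and x: "x \<in> carrier R"
  shows "extension (adj L x) = F.adj (extension L) (fr x \<one>)"
proof
  note id = F.adj_ideal[OF extension_ideal[OF L] fraction_closed[OF x one_in_S]]
  show "F.adj (extension L) (fr x \<one>) \<subseteq> extension (adj L x)"
    using subset_adj[OF L x] self_in_adj[OF L x] one_in_S x
    by (intro F.adj_minimal[OF extension_ideal[OF L]] extension_ideal adj_ideal[OF L x])
      (auto simp: fraction_mem_extension, auto simp: extension_def)
  show "extension (adj L x) \<subseteq> F.adj (extension L) (fr x \<one>)"
  proof
    fix y assume "y \<in> extension (adj L x)"
    then obtain l r s where l: "l \<in> L" "r \<in> carrier R" "s \<in> S" "y = fr (l \<oplus> r \<otimes> x) s"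
      unfolding extension_def by (auto elim!: adjE)
    have lc: "l \<in> carrier R" using l ideal_carrier[OF L] by auto
    have "fr l \<one> \<oplus>\<^bsub>F\<^esub> fr r \<one> \<otimes>\<^bsub>F\<^esub> fr x \<one> \<in> F.adj (extension L) (fr x \<one>)"
      using l by (intro F.adjI fraction_mem_extension) auto
    then have "fr (l \<oplus> r \<otimes> x) \<one> \<in> F.adj (extension L) (fr x \<one>)" using l lc x by simp
    then show "y \<in> F.adj (extension L) (fr x \<one>)"
      using fraction_mem_ideal_iff[OF id, of "l \<oplus> r \<otimes> x" s \<one>] l lc x by auto
  qed
qed

text \<open>Exactness of localization: the relation for a numerator \<open>b\<close> holds in
  \<open>L\<close> after multiplying by some \<open>u \<in> S\<close>, and \<open>u\<close> is
  absorbed into \<open>b\<close> before \<open>x\<close> is cancelled.\<close>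

lemma nzd_extension:
  assumes L: "ideal L R" and x: "nzd L x"
  shows "F.nzd (extension L) (fr x \<one>)"
  unfolding F.nzd_def
proof (intro conjI ballI impI)
  have xc: "x \<in> carrier R" using x unfolding nzd_def by auto
  then show "fr x \<one> \<in> carrier F" by simp
  fix y assume y: "y \<in> carrier F" "fr x \<one> \<otimes>\<^bsub>F\<^esub> y \<in> extension L"
  from y(1) obtain b t where b: "b \<in> carrier R" "t \<in> S" "y = fr b t" by (rule carrier_FE)
  then obtain u where u: "u \<in> S" "u \<otimes> (x \<otimes> b) \<in> L"
    using y(2) fraction_mem_extension_iff[OF L, of "x \<otimes> b" t] xc by auto
  then have "x \<otimes> (u \<otimes> b) \<in> L" using xc b by (simp add: m_lcomm)
  then have "u \<otimes> b \<in> L" using x u b unfolding nzd_def by auto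
  then show "y \<in> extension L" using fraction_mem_extension_iff[OF L b(1,2)] u b by auto
qed

lemma regular_over_extension:
  assumes "ideal L R" "regular_over L xs"
  shows "F.regular_over (extension L) (map (\<lambda>x. fr x \<one>) xs)"
  using assms
proof (induction xs arbitrary: L)
  case (Cons x xs)
  have x: "x \<in> carrier R" "nzd L x" using Cons.prems unfolding regular_over.simps nzd_def by auto
  show ?case
    using Cons.IH[OF adj_ideal[OF Cons.prems(1) x(1)]] Cons.prems nzd_extension[OF Cons.prems(1) x(2)]
      extension_adj[OF Cons.prems(1) x(1)] by auto
qed simp

lemma adjoin_extension:
  assumes "ideal L R" "set xs \<subseteq> carrier R"
  shows "F.adjoin (extension L) (map (\<lambda>x. fr x \<one>) xs) = extension (adjoin L xs)"
  using assms
proof (induction xs arbitrary: L)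
  case (Cons x xs)
  then show ?case using Cons.IH[OF adj_ideal[of L x]] extension_adj[of L x] by auto
qed simp

end

section \<open>The local ring at a prime\<close>

locale prime_localization = noetherian_cring R for R (structure) +
  fixes P
  assumes prime: "primeideal P R"

sublocale prime_localization \<subseteq> multiplicative_subset R "carrier R - P"
  using prime_one[OF prime] prime_mult[OF prime] by unfold_locales auto

sublocale prime_localization \<subseteq> F: noetherian_cring "fraction_ring R (carrier R - P)"
  using noetherian_fraction_ring noetherian_ring_axioms
  by (intro noetherian_cring.intro F.cring_axioms)

context prime_localization
begin

lemma fraction_mem_extension_prime_iff:
  assumes "primeideal Q R" "Q \<subseteq> P" "a \<in> carrier R" "s \<in> carrier R - P"
  shows "fr a s \<in> extension Q \<longleftrightarrow> a \<in> Q"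
proof -
  have "(\<exists>u\<in>carrier R - P. u \<otimes> a \<in> Q) \<longleftrightarrow> a \<in> Q"
    using assms prime_mult[OF assms(1) _ assms(3)] ideal_lmult[OF prime_ideal[OF assms(1)]] one_in_S by blast
  then show ?thesis using fraction_mem_extension_iff[OF prime_ideal[OF assms(1)] assms(3,4)] by simp
qed

lemma localized_ideal_eq_extension: "localized_ideal R P = extension P"
  unfolding localized_ideal_def localization_def
proof
  let ?B = "(\<lambda>a. fr a \<one>) ` P"
  have B: "?B \<subseteq> carrier F" using ideal_carrier[OF prime_ideal[OF prime]] one_in_S by auto
  show "Idl\<^bsub>F\<^esub> ?B \<subseteq> extension P"
    using one_in_S by (intro F.genideal_minimal[OF extension_ideal[OF prime_ideal[OF prime]]])
      (auto simp: fraction_mem_extension)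
  show "extension P \<subseteq> Idl\<^bsub>F\<^esub> ?B"
  proof
    fix x assume "x \<in> extension P"
    then obtain a s where a: "a \<in> P" "s \<in> carrier R - P" "x = fr a s" unfolding extension_def by blast
    moreover have "fr a \<one> \<in> Idl\<^bsub>F\<^esub> ?B" using F.genideal_self[OF B] a(1) by auto
    ultimately show "x \<in> Idl\<^bsub>F\<^esub> ?B"
      using fraction_mem_ideal_iff[OF F.genideal_ideal[OF B] _ a(2) one_in_S]
        ideal_carrier[OF prime_ideal[OF prime]] by auto
  qed
qed

text \<open>A fraction whose numerator is outside \<open>P\<close> is a unit.\<close>

lemma proper_ideal_subset_extension:
  assumes K: "ideal K F" "K \<noteq> carrier F"
  shows "K \<subseteq> extension P"
proof
  fix x assume x: "x \<in> K"
  then obtain a s where a: "a \<in> carrier R" "s \<in> carrier R - P" "x = fr a s"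
    using F.ideal_carrier[OF K(1)] carrier_FE by metis
  have "a \<in> P"
  proof (rule ccontr)
    assume "a \<notin> P"
    then have aS: "a \<in> carrier R - P" using a by auto
    have "fr (s \<otimes> a) (a \<otimes> s) = fr \<one> \<one>"
      using a(1,2) aS mult_in_S one_in_S by (intro fraction_eqI) (auto simp: m_comm)
    moreover have "fr s a \<otimes>\<^bsub>F\<^esub> x = fr (s \<otimes> a) (a \<otimes> s)"
      unfolding a(3) using a(1,2) aS by (intro fraction_mult) auto
    moreover have "fr s a \<otimes>\<^bsub>F\<^esub> x \<in> K"
      using a(2) aS by (intro F.ideal_lmult[OF K(1) _ x] fraction_closed) auto
    ultimately have "\<one>\<^bsub>F\<^esub> \<in> K" unfolding one_F by simp
    then show False using F.ideal_eq_carrier[OF K(1)] K(2) by auto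
  qed
  then show "x \<in> extension P" using a by (simp add: fraction_mem_extension)
qed

lemma extension_proper: "\<one>\<^bsub>F\<^esub> \<notin> extension P" "extension P \<noteq> carrier F"
proof -
  show "\<one>\<^bsub>F\<^esub> \<notin> extension P"
    unfolding one_F fraction_mem_extension_prime_iff[OF prime order_refl one_closed one_in_S]
    by (rule prime_one[OF prime])
  then show "extension P \<noteq> carrier F" using F.one_closed by metis
qed

text \<open>This identifies the ideal that \<open>local_depth\<close> picks by description.\<close>

lemma maximalideal_iff: "maximalideal M F \<longleftrightarrow> M = extension P"
proof
  note id = extension_ideal[OF prime_ideal[OF prime]]
  { assume M: "maximalideal M F"
    then interpret M: maximalideal M F .
    have "M \<subseteq> extension P" using proper_ideal_subset_extension M.is_ideal M.I_notcarr by auto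
    then show "M = extension P"
      using M.I_maximal[OF id _ F.ideal_subset[OF id]] extension_proper by auto }
  assume "M = extension P"
  then show "maximalideal M F"
    using id extension_proper proper_ideal_subset_extension by (intro maximalidealI) auto
qed

lemma local_depth_eq: "local_depth (localization R P) = depth F (extension P)"
  unfolding local_depth_def localization_def maximalideal_iff by simp

lemma prime_extension: "primeideal (extension P) F"
proof (rule F.primeI)
  fix x y assume "x \<in> carrier F" "y \<in> carrier F"
    and xy: "x \<otimes>\<^bsub>F\<^esub> y \<in> extension P" "x \<notin> extension P"
  then obtain a s b t where a: "a \<in> carrier R" "s \<in> carrier R - P" "x = fr a s"
    "b \<in> carrier R" "t \<in> carrier R - P" "y = fr b t"
    by (metis carrier_FE)
  have "fr (a \<otimes> b) (s \<otimes> t) \<in> extension P" using xy(1) a by simp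
  then have "a \<otimes> b \<in> P"
    using fraction_mem_extension_prime_iff[OF prime order_refl m_closed[OF a(1,4)] mult_in_S[OF a(2,5)]] by simp
  then show "y \<in> extension P"
    using prime_mult[OF prime a(1,4)] xy(2) a by (auto simp: fraction_mem_extension)
qed (use extension_ideal[OF prime_ideal[OF prime]] extension_proper in auto)

lemma prime_contraction:
  assumes K: "primeideal K F"
  shows "primeideal (contraction K) R"
proof (rule primeI)
  show "ideal (contraction K) R" by (rule contraction_ideal[OF F.prime_ideal[OF K]])
  show "\<one> \<notin> contraction K" using F.prime_one[OF K] unfolding contraction_def one_F by auto
  fix a b assume ab: "a \<in> carrier R" "b \<in> carrier R" "a \<otimes> b \<in> contraction K" "a \<notin> contraction K"
  then have "fr a \<one> \<otimes>\<^bsub>F\<^esub> fr b \<one> \<in> K" "fr a \<one> \<notin> K"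
    using one_in_S unfolding contraction_def by auto
  then show "b \<in> contraction K"
    using F.prime_mult[OF K, of "fr a \<one>" "fr b \<one>"] ab one_in_S unfolding contraction_def by auto
qed

lemma contraction_strict_mono:
  assumes K: "ideal K F" and L: "ideal L F" and "K \<subset> L"
  shows "contraction K \<subset> contraction L"
proof -
  obtain x where x: "x \<in> L" "x \<notin> K" using assms by auto
  then obtain a s where a: "a \<in> carrier R" "s \<in> carrier R - P" "x = fr a s"
    using F.ideal_carrier[OF L] carrier_FE by metis
  then have "a \<in> contraction L" "a \<notin> contraction K"
    using x fraction_mem_iff_contraction[OF K] fraction_mem_iff_contraction[OF L] by auto
  moreover have "contraction K \<subseteq> contraction L" using assms unfolding contraction_def by auto
  ultimately show ?thesis by auto
qed

text \<open>An ideal of \<open>F\<close> can be recovered from its contraction, so strict inclusions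
  survive, and the maximal ideal contracts to \<open>P\<close>.\<close>

lemma prime_chain_contraction:
  assumes "F.prime_chain p k (extension P)"
  shows "prime_chain (\<lambda>i. contraction (p i)) k P"
proof -
  have p: "primeideal (p i) F" if "i \<le> k" for i using assms that unfolding F.prime_chain_def by auto
  have "contraction (extension P) = P"
    using fraction_mem_extension_prime_iff[OF prime order_refl _ one_in_S]
      ideal_carrier[OF prime_ideal[OF prime]] unfolding contraction_def by auto
  moreover have "contraction (p i) \<subset> contraction (p (Suc i))" if "i < k" for i
    using contraction_strict_mono[OF F.prime_ideal[OF p] F.prime_ideal[OF p]] assms that
    unfolding F.prime_chain_def by auto
  ultimately show ?thesis using assms prime_contraction p unfolding F.prime_chain_def prime_chain_def by auto
qed

text \<open>Associated primes are compatible with localization. In the harder direction each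
  \<open>q \<in> P\<close> comes with its own multiplier outside \<open>P\<close>. A common one is a
  \<open>t\<close> with \<open>colon L (t \<otimes> a)\<close> maximal: a further multiplier cannot
  enlarge this ideal, so it contains \<open>P\<close>, and it lies in \<open>P\<close> because no
  multiple of \<open>a\<close> by an element outside \<open>P\<close> is in
  \<open>L\<close>.\<close>

lemma annihilated_extension_iff:
  assumes L: "ideal L R"
  shows "F.annihilated (extension P) (extension L) \<longleftrightarrow> P \<in> assoc_primes L"
proof
  assume "P \<in> assoc_primes L"
  then obtain a where a: "a \<in> carrier R" "P = colon L a" unfolding assoc_primes_def by auto
  have mem_P: "r \<in> P \<longleftrightarrow> r \<in> carrier R \<and> r \<otimes> a \<in> L" for r
    using a(2) unfolding colon_def by blast
  have "fr a \<one> \<notin> extension L"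
    unfolding fraction_mem_extension_iff[OF L a(1) one_in_S] using mem_P by blast
  moreover have "x \<otimes>\<^bsub>F\<^esub> fr a \<one> \<in> extension L" if x: "x \<in> extension P" for x
  proof -
    obtain q s where q: "q \<in> P" "s \<in> carrier R - P" "x = fr q s"
      using x unfolding extension_def by blast
    have qa: "q \<in> carrier R" "q \<otimes> a \<in> L" using q(1) mem_P by blast+
    have "fr q s \<otimes>\<^bsub>F\<^esub> fr a \<one> = fr (q \<otimes> a) (s \<otimes> \<one>)" using qa(1) a(1) q(2) one_in_S by (rule fraction_mult)
    then show ?thesis unfolding q(3) using fraction_mem_extension[OF qa(2) mult_in_S[OF q(2) one_in_S]] by simp
  qed
  ultimately show "F.annihilated (extension P) (extension L)"
    using a(1) one_in_S unfolding F.annihilated_def by (intro bexI[of _ "fr a \<one>"]) auto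
next
  assume "F.annihilated (extension P) (extension L)"
  then obtain x where x: "x \<in> carrier F" "x \<notin> extension L"
    "\<And>y. y \<in> extension P \<Longrightarrow> y \<otimes>\<^bsub>F\<^esub> x \<in> extension L"
    unfolding F.annihilated_def by auto
  from x(1) obtain a s where a: "a \<in> carrier R" "s \<in> carrier R - P" "x = fr a s" by (rule carrier_FE)
  have ann: "\<exists>t\<in>carrier R - P. t \<otimes> (q \<otimes> a) \<in> L" if q: "q \<in> P" for q
  proof -
    have qc: "q \<in> carrier R" using q ideal_carrier[OF prime_ideal[OF prime]] by auto
    have "fr q \<one> \<otimes>\<^bsub>F\<^esub> x \<in> extension L" using q one_in_S by (intro x(3) fraction_mem_extension)
    then have "fr (q \<otimes> a) s \<in> extension L" using a qc one_in_S by simp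
    then show ?thesis using fraction_mem_extension_iff[OF L m_closed[OF qc a(1)] a(2)] by auto
  qed
  have not_in: "t \<otimes> a \<notin> L" if "t \<in> carrier R - P" for t
    using x(2) fraction_mem_extension_iff[OF L a(1,2)] a(3) that by auto
  let ?X = "{colon L (t \<otimes> a) | t. t \<in> carrier R - P}"
  have "?X \<noteq> {}" using one_in_S by blast
  then have "\<exists>M\<in>?X. \<forall>Y\<in>?X. M \<subseteq> Y \<longrightarrow> Y = M"
    by (rule exists_maximal_ideal_in) (use a(1) colon_ideal[OF L] in \<open>auto simp: colon_def\<close>)
  then obtain M where MX: "M \<in> ?X" and max: "\<forall>Y\<in>?X. M \<subseteq> Y \<longrightarrow> Y = M" by (rule bexE)
  obtain t where t: "t \<in> carrier R - P" "M = colon L (t \<otimes> a)" using MX by blast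
  have tc: "t \<in> carrier R" using t by auto
  have "P = M"
  proof
    show "M \<subseteq> P"
    proof
      fix r assume r: "r \<in> M"
      then have rc: "r \<in> carrier R" "(r \<otimes> t) \<otimes> a \<in> L" unfolding t(2) colon_def using tc a(1) by (auto simp: m_assoc)
      then show "r \<in> P" using not_in[of "r \<otimes> t"] mult_in_S[OF _ t(1), of r] by auto
    qed
    show "P \<subseteq> M"
    proof
      fix q assume q: "q \<in> P"
      then have qc: "q \<in> carrier R" using ideal_carrier[OF prime_ideal[OF prime]] by auto
      obtain v where v: "v \<in> carrier R - P" "v \<otimes> (q \<otimes> a) \<in> L" using ann[OF q] by auto
      have vc: "v \<in> carrier R" using v by auto
      have swap: "r \<otimes> ((v \<otimes> t) \<otimes> a) = v \<otimes> (r \<otimes> (t \<otimes> a))" if "r \<in> carrier R" for r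
        using that vc tc a(1) by algebra
      have "colon L ((v \<otimes> t) \<otimes> a) \<in> ?X" using mult_in_S[OF v(1) t(1)] by blast
      moreover have "M \<subseteq> colon L ((v \<otimes> t) \<otimes> a)"
        unfolding t(2) colon_def using swap ideal_lmult[OF L vc] by auto
      ultimately have "colon L ((v \<otimes> t) \<otimes> a) = M" using max by blast
      moreover have "q \<otimes> ((v \<otimes> t) \<otimes> a) = t \<otimes> (v \<otimes> (q \<otimes> a))" using qc vc tc a(1) by algebra
      then have "q \<in> colon L ((v \<otimes> t) \<otimes> a)"
        unfolding colon_def using ideal_lmult[OF L tc v(2)] qc by simp
      ultimately show "q \<in> M" by simp
    qed
  qed
  then show "P \<in> assoc_primes L"
    using prime t(2) tc a(1) unfolding assoc_primes_def by auto
qed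

section \<open>Depth of the localization\<close>

abbreviation "local_depth_at \<equiv> depth F (extension P)"

lemma regular_over_localization:
  assumes "regular_over {\<zero>} xs" "set xs \<subseteq> P"
  shows "F.regular_over {\<zero>\<^bsub>F\<^esub>} (map (\<lambda>x. fr x \<one>) xs)" "set (map (\<lambda>x. fr x \<one>) xs) \<subseteq> extension P"
    "F.annihilated (extension P) (F.adjoin {\<zero>\<^bsub>F\<^esub>} (map (\<lambda>x. fr x \<one>) xs)) \<longleftrightarrow>
      P \<in> assoc_primes (adjoin {\<zero>} xs)"
proof -
  note xs = regular_over_carrier[OF assms(1)]
  show "F.regular_over {\<zero>\<^bsub>F\<^esub>} (map (\<lambda>x. fr x \<one>) xs)"
    using regular_over_extension[OF zeroideal assms(1)] extension_zero by simp
  show "set (map (\<lambda>x. fr x \<one>) xs) \<subseteq> extension P"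
    using assms(2) one_in_S by (auto simp: fraction_mem_extension)
  show "F.annihilated (extension P) (F.adjoin {\<zero>\<^bsub>F\<^esub>} (map (\<lambda>x. fr x \<one>) xs)) \<longleftrightarrow>
      P \<in> assoc_primes (adjoin {\<zero>} xs)"
    using annihilated_extension_iff[OF adjoin_ideal[OF zeroideal xs]] adjoin_extension[OF zeroideal xs]
      extension_zero by simp
qed

lemmas extension_P_ideal = extension_ideal[OF prime_ideal[OF prime]]

lemma depth_localization_ge:
  assumes "regular_over {\<zero>} xs" "set xs \<subseteq> P"
  shows "length xs \<le> local_depth_at"
  using F.length_le_depth[OF extension_P_ideal extension_proper(2) regular_over_localization(1,2)[OF assms]]
  by simp

text \<open>The images of \<open>xs\<close> are regular in the local ring, so their number is the
  depth exactly when they are maximal, that is, when the maximal ideal kills a nonzero class modulo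
  them.\<close>

lemma depth_localization_eq_iff:
  assumes "regular_over {\<zero>} xs" "set xs \<subseteq> P"
  shows "local_depth_at = length xs \<longleftrightarrow> P \<in> assoc_primes (adjoin {\<zero>} xs)"
proof
  note reg = regular_over_localization[OF assms]
  note F_max = F.maximal_regular_sequence_iff[OF extension_P_ideal extension_proper(2)]
  { assume "local_depth_at = length xs"
    then show "P \<in> assoc_primes (adjoin {\<zero>} xs)"
      using F.annihilated_of_length_depth[OF extension_P_ideal extension_proper(2) reg(1,2)] reg(3) by simp }
  assume "P \<in> assoc_primes (adjoin {\<zero>} xs)"
  then have "maximal_regular_sequence_in F (extension P) (map (\<lambda>x. fr x \<one>) xs)"
    using F_max reg by blast
  then show "local_depth_at = length xs"
    using F.depth_eq[OF extension_P_ideal extension_proper(2)] by fastforce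
qed

text \<open>A sequence realizing the depth exists only in the localization, so the chain is built
  there and contracted to \<open>R\<close>.\<close>

lemma prime_chain_of_length_depth: "\<exists>p. prime_chain p local_depth_at P"
proof -
  obtain ys where ys: "maximal_regular_sequence_in F (extension P) ys" "length ys = local_depth_at"
    using F.depth_witness[OF extension_P_ideal extension_proper(2)] .
  then have "F.regular_over {\<zero>\<^bsub>F\<^esub>} ys" "set ys \<subseteq> extension P"
    unfolding F.maximal_regular_sequence_iff[OF extension_P_ideal extension_proper(2)] by auto
  then obtain p where "F.prime_chain p (length ys) (extension P)"
    using F.regular_sequence_prime_chain[OF F.zeroideal _ prime_extension]
      F.ideal_zero[OF extension_P_ideal] by auto
  then show ?thesis using prime_chain_contraction ys(2) by auto
qed

end

section \<open>The two implications\<close>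

context noetherian_cring
begin

abbreviation depth_at :: "'a set \<Rightarrow> nat"
  where "depth_at P \<equiv> local_depth (localization R P)"

lemma prime_localizationI: "primeideal P R \<Longrightarrow> prime_localization R P"
  by (intro prime_localization.intro prime_localization_axioms.intro noetherian_cring_axioms)

lemma depth_at_ge:
  assumes "primeideal P R" "regular_over {\<zero>} xs" "set xs \<subseteq> P"
  shows "length xs \<le> depth_at P"
  using prime_localization.depth_localization_ge[OF prime_localizationI assms(2,3)]
    prime_localization.local_depth_eq[OF prime_localizationI] assms(1) by simp

lemma depth_at_eq_iff:
  assumes "primeideal P R" "regular_over {\<zero>} xs" "set xs \<subseteq> P"
  shows "depth_at P = length xs \<longleftrightarrow> P \<in> assoc_primes (adjoin {\<zero>} xs)"
  using prime_localization.depth_localization_eq_iff[OF prime_localizationI assms(2,3)]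
    prime_localization.local_depth_eq[OF prime_localizationI] assms(1) by simp

lemma prime_chain_depth_at: "primeideal P R \<Longrightarrow> \<exists>p. prime_chain p (depth_at P) P"
  using prime_localization.prime_chain_of_length_depth[OF prime_localizationI]
    prime_localization.local_depth_eq[OF prime_localizationI] by simp

lemma almost_cohen_macaulay_iff:
  "almost_cohen_macaulay R \<longleftrightarrow> (\<forall>P. primeideal P R \<longrightarrow> depth R P = depth_at P)"
proof -
  have "depth (localization R P) (localized_ideal R P) = depth_at P" if "primeideal P R" for P
  proof -
    interpret prime_localization R P using prime_localizationI[OF that] .
    show ?thesis unfolding local_depth_eq localized_ideal_eq_extension unfolding localization_def ..
  qed
  then show ?thesis unfolding almost_cohen_macaulay_def by auto
qed

lemma height_le_iff: "height R P \<le> enat n \<longleftrightarrow> (\<forall>k p. prime_chain p k P \<longrightarrow> k \<le> n)"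
  unfolding height_def prime_chain_def[symmetric] setcompr_eq_image Sup_le_iff by auto

lemma property_C_all_iff:
  "(\<forall>n. property_C n R) \<longleftrightarrow> (\<forall>P. primeideal P R \<longrightarrow> height R P \<le> enat (Suc (depth_at P)))"
proof -
  have "(\<forall>n. min h (enat n) - 1 \<le> enat d) \<longleftrightarrow> h \<le> enat (Suc d)" for h d
  proof
    assume "\<forall>n. min h (enat n) - 1 \<le> enat d"
    \<comment> \<open>\<open>n = d + 2\<close> is the least value at which the truncated bound
      excludes heights above \<open>d + 1\<close>, the infinite one included.\<close>
    then have "min h (enat (Suc (Suc d))) - 1 \<le> enat d" by blast
    then show "h \<le> enat (Suc d)" by (cases h) (auto simp: one_enat_def min_def split: if_splits)
  next
    assume "h \<le> enat (Suc d)"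
    then show "\<forall>n. min h (enat n) - 1 \<le> enat d" by (cases h) (auto simp: one_enat_def min_def)
  qed
  then show ?thesis unfolding property_C_def by blast
qed

lemma height_le_of_almost_cohen_macaulay:
  assumes acm: "\<And>Q. primeideal Q R \<Longrightarrow> depth R Q = depth_at Q" and P: "primeideal P R"
  shows "height R P \<le> enat (Suc (depth_at P))"
  unfolding height_le_iff
proof (intro allI impI)
  fix k p assume p: "prime_chain p k P"
  note id = prime_ideal[OF P] prime_proper[OF P]
  obtain xs where xs: "maximal_regular_sequence_in R P xs" "length xs = depth R P"
    using depth_witness[OF id] .
  then have reg: "regular_over {\<zero>} xs" "set xs \<subseteq> P"
    using maximal_regular_sequence_iff[OF id] by auto
  have xsc: "set xs \<subseteq> carrier R" by (rule regular_over_carrier[OF reg(1)])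
  let ?L = "adjoin {\<zero>} xs"
  have L: "ideal ?L R" by (rule adjoin_ideal[OF zeroideal xsc])
  have assoc: "Q \<in> assoc_primes ?L" if Q: "primeideal Q R" "set xs \<subseteq> Q" "Q \<subseteq> P" for Q
  proof -
    \<comment> \<open>A regular extension of \<open>xs\<close> by an element of \<open>Q\<close>
      would also be one by an element of \<open>P\<close>.\<close>
    have "maximal_regular_sequence_in R Q xs"
      using xs(1) Q unfolding maximal_regular_sequence_in_def by auto
    then have "depth R Q = length xs" by (rule depth_eq[OF prime_ideal[OF Q(1)] prime_proper[OF Q(1)]])
    then show ?thesis using depth_at_eq_iff[OF Q(1) reg(1) Q(2)] acm[OF Q(1)] by simp
  qed
  have "\<exists>y\<in>P. \<forall>Q. primeideal Q R \<and> set xs \<subseteq> Q \<and> Q \<subset> P \<longrightarrow> y \<notin> Q"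
  proof (rule ccontr)
    let ?F = "{Q \<in> assoc_primes ?L. Q \<subset> P}"
    assume "\<not> ?thesis"
    then have "P \<subseteq> \<Union>?F" using assoc by blast
    moreover have "finite ?F" using finite_assoc_primes[OF L] by auto
    moreover have "primeideal Q R" if "Q \<in> ?F" for Q using that unfolding assoc_primes_def by blast
    ultimately have "\<exists>Q\<in>?F. P \<subseteq> Q" using id(1) by (intro prime_avoidance) blast+
    then show False by blast
  qed
  then obtain y where y: "y \<in> P" "\<And>Q. primeideal Q R \<Longrightarrow> set xs \<subseteq> Q \<Longrightarrow> Q \<subset> P \<Longrightarrow> y \<notin> Q" by blast
  have "k \<le> card (insert y (set xs))"
    using y reg(2) by (intro krull_height[OF _ P _ p]) auto
  also have "\<dots> \<le> Suc (length xs)" using card_insert_le_m1 card_length[of xs] card_insert_if[of "set xs" y] by simp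
  finally show "k \<le> Suc (depth_at P)" using xs(2) acm[OF P] by simp
qed

lemma depth_eq_depth_at_of_height_le:
  assumes ht: "\<And>Q. primeideal Q R \<Longrightarrow> height R Q \<le> enat (Suc (depth_at Q))" and P: "primeideal P R"
  shows "depth R P = depth_at P"
proof -
  note id = prime_ideal[OF P] prime_proper[OF P]
  obtain xs where xs: "maximal_regular_sequence_in R P xs" "length xs = depth R P"
    using depth_witness[OF id] .
  then have reg: "regular_over {\<zero>} xs" "set xs \<subseteq> P" "annihilated P (adjoin {\<zero>} xs)"
    using maximal_regular_sequence_iff[OF id] by auto
  have xsc: "set xs \<subseteq> carrier R" by (rule regular_over_carrier[OF reg(1)])
  note L = adjoin_ideal[OF zeroideal xsc]
  obtain Q where Q: "Q \<in> assoc_primes (adjoin {\<zero>} xs)" "P \<subseteq> Q"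
    using annihilated_iff(2)[OF id(1) L] reg(3) by auto
  have prQ: "primeideal Q R" using Q(1) unfolding assoc_primes_def by auto
  have dQ: "depth_at Q = length xs" using depth_at_eq_iff[OF prQ reg(1)] Q reg(2) by auto
  have le: "length xs \<le> depth_at P" by (rule depth_at_ge[OF P reg(1,2)])
  show ?thesis
  proof (cases "Q = P")
    case True
    then show ?thesis using dQ xs(2) by simp
  next
    case False
    \<comment> \<open>A chain of length \<open>depth_at P\<close> ending in \<open>P\<close>,
      continued by \<open>Q\<close>, bounds \<open>depth_at P + 1\<close> by the height of
      \<open>Q\<close>.\<close>
    obtain p where p: "prime_chain p (depth_at P) P" using prime_chain_depth_at[OF P] by auto
    have "prime_chain (p(Suc (depth_at P) := Q)) (Suc (depth_at P)) Q"
      using p prQ Q(2) False unfolding prime_chain_def by (auto simp: less_Suc_eq le_Suc_eq)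
    then have "Suc (depth_at P) \<le> Suc (depth_at Q)" using ht[OF prQ] unfolding height_le_iff by blast
    then show ?thesis using le dQ xs(2) by simp
  qed
qed

end

theorem theorem3p3:
  fixes A :: "('a, 'b) ring_scheme"
  assumes "cring A" and "noetherian_ring A"
  shows "almost_cohen_macaulay A \<longleftrightarrow> (\<forall>n::nat. property_C n A)"
proof -
  interpret noetherian_cring A using assms by (intro noetherian_cring.intro)
  show ?thesis
    unfolding almost_cohen_macaulay_iff property_C_all_iff
    using height_le_of_almost_cohen_macaulay depth_eq_depth_at_of_height_le by blast
qed

end
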